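(* Let $p$ be a prime and $\mathbb{K}$ a perfect field of characteristic $p$. The equations (for $a,b\in S\cap[0,1)$) $$\theta(\delta_b)\,\xi_a=\xi_{a+b},\qquad \theta(\tilde\mu_p)\,\xi_a=\xi_{\frac{a+p-1}{p}},\qquad \theta(\mu_p^* )\,\xi_a=\xi_{pa}$$ define a faithful representation $\theta:\mathcal{C}_p\to\mathrm{End}(\mathbb{K}[S\cap[0,1)])$ of the algebra $\mathcal{C}_p$ by lower triangular matrices $T=(T_{a,b})$, $T_{a,b}\in\mathbb{K}$, with $a,b\in S\cap[0,1)$.
   Context: $S=\bigcup_n\frac{1}{p^n}\mathbb{Z}\subset\mathbb{R}$. $\mathbb{K}[S\cap[0,1)]$ is the $\mathbb{K}$-vector space of finitely supported $\mathbb{K}$-valued functions on $S\cap[0,1)$, with canonical basis $\xi_a$, $a\in S\cap[0,1)$; by convention $\xi_a=0$ for $a\in S$, $a\ge1$. The matrix of an endomorphism $T$ is given by $(Tf)(a)=\sum_bT_{a,b}f(b)$; lower triangular means $T_{a,b}=0$ unless $a\ge b$. Integral BC-algebra: $\mathbb{Z}[\mathbb{Q}/\mathbb{Z}]$ is the group ring with basis $e(r)$; for $n\in\mathbb{N}$ (positive integers) $\sigma_n(e(r))=e(nr)$ (ring endomorphism) and $\tilde\rho_n(e(r))=\sum_{ns=r}e(s)$ (additive map). $\mathcal{A}_{\mathbb{Z}}$ is the unital ring generated by $\mathbb{Z}[\mathbb{Q}/\mathbb{Z}]$ and elements $\tilde\mu_n,\mu_n^*$ ($n\in\mathbb{N}$),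 subject to: $\tilde\mu_nx\mu_n^*=\tilde\rho_n(x)$; $\mu_n^*x=\sigma_n(x)\mu_n^*$; $x\tilde\mu_n=\tilde\mu_n\sigma_n(x)$; $\tilde\mu_{nm}=\tilde\mu_n\tilde\mu_m$; $\mu_{nm}^*=\mu_n^*\mu_m^*$; $\mu_n^*\tilde\mu_n=n$; $\tilde\mu_n\mu_m^*=\mu_m^*\tilde\mu_n$ if $\gcd(n,m)=1$. $A_{p^\infty}=\mathbb{K}[\mathbb{Q}_p/\mathbb{Z}_p]$ is the group algebra of the subgroup $\mathbb{Q}_p/\mathbb{Z}_p\subset\mathbb{Q}/\mathbb{Z}$ of fractions with denominator a power of $p$. The $p$-part $\mathcal{C}_p=A_{p^\infty}\rtimes_{\tilde\rho}p^{\mathbb{N}}$ is the $\mathbb{K}$-subalgebra of $\mathcal{A}_{\mathbb{Z}}\otimes_{\mathbb{Z}}\mathbb{K}$ generated by $A_{p^\infty}$, $\tilde\mu_p$ and $\mu_p^*$. $A_{p^\infty}$ is identified with the algebra $\mathcal{T}(p)$ of finitely supported $\mathbb{K}$-valued functions on $S\cap[0,\infty)$ under convolution $f_1\star f_2(c)=\sum_{a+b=c}f_1(a)f_2(b)$, modulo the ideal of functions supported in $S\cap[1,\infty)$, via $e(1/p^\ell)\mapsto\mathbf{1}-\delta_{p^{-\ell}}$, where $\delta_a$ is the function equal to $1$ at $a$ and $0$ elsewhere and $\mathbf{1}=\delta_0$. Thus, for $a=k/p^\ell\in S\cap[0,1)$, $\delta_a\in\mathcal{C}_p$ denotes the element $(1-e(1/p^\ell))^k$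 of $A_{p^\infty}$. *)

theory Defs
  imports Complex_Main "HOL-Library.Poly_Mapping" "HOL-Library.FuncSet"
    "HOL-Computational_Algebra.Computational_Algebra"
begin

section \<open>The group ring of $\mathbb{Q}/\mathbb{Z}$\<close>

quotient_type qz = rat / "\<lambda>x y. x - y \<in> \<int>"
  morphisms rep_qz qz_of
proof (rule equivpI)
  show "symp (\<lambda>x y :: rat. x - y \<in> \<int>)"
    by (rule sympI) (metis Ints_minus minus_diff_eq)
  show "transp (\<lambda>x y :: rat. x - y \<in> \<int>)"
  proof (rule transpI)
    fix x y z :: rat
    assume "x - y \<in> \<int>" "y - z \<in> \<int>"
    then have "(x - y) + (y - z) \<in> \<int>" by (rule Ints_add)
    then show "x - z \<in> \<int>" by simp
  qed
qed (simp add: reflp_def)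

instantiation qz :: ab_group_add
begin

lift_definition zero_qz :: qz is 0 .

lift_definition plus_qz :: "qz \<Rightarrow> qz \<Rightarrow> qz" is "(+)"
proof -
  fix a b c d :: rat
  assume "a - b \<in> \<int>" "c - d \<in> \<int>"
  then have "(a - b) + (c - d) \<in> \<int>" by (rule Ints_add)
  then show "(a + c) - (b + d) \<in> \<int>" by (simp add: algebra_simps)
qed

lift_definition uminus_qz :: "qz \<Rightarrow> qz" is uminus
  by (metis Ints_minus minus_diff_minus)

definition minus_qz :: "qz \<Rightarrow> qz \<Rightarrow> qz"
  where "minus_qz x y = x + - y"

instance
  by standard (simp add: minus_qz_def | transfer, simp add: algebra_simps)+

end

lift_definition qz_times :: "nat \<Rightarrow> qz \<Rightarrow> qz" is "\<lambda>n r. of_nat n * r"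
  by (metis Ints_mult Ints_of_nat right_diff_distrib)

text \<open>
  For a commutative ring \<open>'k\<close>, the type \<open>qz \<Rightarrow>\<^sub>0 'k\<close> with its convolution product is the group
  ring of $\mathbb{Q}/\mathbb{Z}$ over \<open>'k\<close>; it is used with \<open>'k = int\<close> and with \<open>'k\<close> a field.
\<close>

definition e_QZ :: "rat \<Rightarrow> qz \<Rightarrow>\<^sub>0 'k::comm_ring_1"
  where "e_QZ r = Poly_Mapping.single (qz_of r) 1"

definition sigma :: "nat \<Rightarrow> (qz \<Rightarrow>\<^sub>0 int) \<Rightarrow> (qz \<Rightarrow>\<^sub>0 int)"
  where "sigma n = frag_extend (\<lambda>r. frag_of (qz_times n r))"

text \<open>The inner index set has exactly \<open>n\<close> elements for \<open>n > 0\<close>, so it is finite.\<close>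

definition rho :: "nat \<Rightarrow> (qz \<Rightarrow>\<^sub>0 int) \<Rightarrow> (qz \<Rightarrow>\<^sub>0 int)"
  where "rho n = frag_extend (\<lambda>r. \<Sum>s | qz_times n s = r. frag_of s)"


section \<open>The integral BC-algebra\<close>

text \<open>
  Generators and relations: ring expressions in the elements of the group ring and the symbols
  \<open>MuT n\<close> ($\tilde\mu_n$) and \<open>MuS n\<close> ($\mu_n^*$), modulo the least ring congruence containing the
  relations. The index type \<^typ>\<open>num\<close> is used as the type of positive integers.
\<close>

datatype bc_expr =
    Zero | One | Add bc_expr bc_expr | Neg bc_expr | Mult bc_expr bc_expr
  | Grp "qz \<Rightarrow>\<^sub>0 int" | MuT num | MuS num

inductive bc_eq :: "bc_expr \<Rightarrow> bc_expr \<Rightarrow> bool" where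
  \<comment> \<open>equivalence and compatibility with the operations\<close>
  bc_refl: "bc_eq x x"
| bc_sym: "bc_eq x y \<Longrightarrow> bc_eq y x"
| bc_trans: "bc_eq x y \<Longrightarrow> bc_eq y z \<Longrightarrow> bc_eq x z"
| bc_cong_add: "bc_eq x x' \<Longrightarrow> bc_eq y y' \<Longrightarrow> bc_eq (Add x y) (Add x' y')"
| bc_cong_neg: "bc_eq x x' \<Longrightarrow> bc_eq (Neg x) (Neg x')"
| bc_cong_mult: "bc_eq x x' \<Longrightarrow> bc_eq y y' \<Longrightarrow> bc_eq (Mult x y) (Mult x' y')"
  \<comment> \<open>axioms of unital rings\<close>
| bc_add_assoc: "bc_eq (Add (Add x y) z) (Add x (Add y z))"
| bc_add_comm: "bc_eq (Add x y) (Add y x)"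
| bc_add_zero: "bc_eq (Add Zero x) x"
| bc_add_neg: "bc_eq (Add (Neg x) x) Zero"
| bc_mult_assoc: "bc_eq (Mult (Mult x y) z) (Mult x (Mult y z))"
| bc_mult_one_left: "bc_eq (Mult One x) x"
| bc_mult_one_right: "bc_eq (Mult x One) x"
| bc_distrib_right: "bc_eq (Mult (Add x y) z) (Add (Mult x z) (Mult y z))"
| bc_distrib_left: "bc_eq (Mult x (Add y z)) (Add (Mult x y) (Mult x z))"
  \<comment> \<open>\<open>Grp\<close> is a homomorphism of unital rings\<close>
| bc_grp_add: "bc_eq (Grp (f + g)) (Add (Grp f) (Grp g))"
| bc_grp_mult: "bc_eq (Grp (f * g)) (Mult (Grp f) (Grp g))"
| bc_grp_one: "bc_eq (Grp 1) One"
  \<comment> \<open>defining relations of the BC-algebra\<close>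
| bc_rho: "bc_eq (Mult (Mult (MuT n) (Grp f)) (MuS n)) (Grp (rho (nat_of_num n) f))"
| bc_sigma_star: "bc_eq (Mult (MuS n) (Grp f)) (Mult (Grp (sigma (nat_of_num n) f)) (MuS n))"
| bc_sigma_tilde: "bc_eq (Mult (Grp f) (MuT n)) (Mult (MuT n) (Grp (sigma (nat_of_num n) f)))"
| bc_tilde_mult: "bc_eq (MuT (n * m)) (Mult (MuT n) (MuT m))"
| bc_star_mult: "bc_eq (MuS (n * m)) (Mult (MuS n) (MuS m))"
| bc_star_tilde: "bc_eq (Mult (MuS n) (MuT n)) (Grp (of_nat (nat_of_num n)))"
| bc_coprime: "coprime (nat_of_num n) (nat_of_num m) \<Longrightarrow>
    bc_eq (Mult (MuT n) (MuS m)) (Mult (MuS m) (MuT n))"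

quotient_type bc = bc_expr / bc_eq
  by (rule equivpI) (auto simp: reflp_def symp_def transp_def intro: bc_refl bc_sym elim: bc_trans)

instantiation bc :: "{ring, monoid_mult}"
begin

lift_definition zero_bc :: bc is Zero .
lift_definition one_bc :: bc is One .
lift_definition plus_bc :: "bc \<Rightarrow> bc \<Rightarrow> bc" is Add by (rule bc_cong_add)
lift_definition uminus_bc :: "bc \<Rightarrow> bc" is Neg by (rule bc_cong_neg)
lift_definition times_bc :: "bc \<Rightarrow> bc \<Rightarrow> bc" is Mult by (rule bc_cong_mult)

definition minus_bc :: "bc \<Rightarrow> bc \<Rightarrow> bc"
  where "minus_bc x y = x + - y"

instance
proof
  fix a b c :: bc
  show "a + b + c = a + (b + c)" by transfer (rule bc_add_assoc)
  show "a + b = b + a" by transfer (rule bc_add_comm)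
  show "0 + a = a" by transfer (rule bc_add_zero)
  show "- a + a = 0" by transfer (rule bc_add_neg)
  show "a - b = a + - b" by (rule minus_bc_def)
  show "a * b * c = a * (b * c)" by transfer (rule bc_mult_assoc)
  show "(a + b) * c = a * c + b * c" by transfer (rule bc_distrib_right)
  show "a * (b + c) = a * b + a * c" by transfer (rule bc_distrib_left)
  show "1 * a = a" by transfer (rule bc_mult_one_left)
  show "a * 1 = a" by transfer (rule bc_mult_one_right)
qed

end

lift_definition bc_grp :: "(qz \<Rightarrow>\<^sub>0 int) \<Rightarrow> bc" is Grp .
lift_definition mu_tilde :: "num \<Rightarrow> bc" is MuT .
lift_definition mu_star :: "num \<Rightarrow> bc" is MuS .


section \<open>The tensor product of two rings over the integers\<close>

text \<open>
  The free abelian group on pairs modulo the subgroup generated by the biadditivity relations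
  (which already imply that the tensor product is balanced over the integers), with
  $(a \otimes b)(a' \otimes b') = aa' \otimes bb'$.
\<close>

inductive_set tensor_null :: "('a::{ring,monoid_mult} \<times> 'b::{ring,monoid_mult} \<Rightarrow>\<^sub>0 int) set" where
  tn_zero: "0 \<in> tensor_null"
| tn_diff: "x \<in> tensor_null \<Longrightarrow> y \<in> tensor_null \<Longrightarrow> x - y \<in> tensor_null"
| tn_left: "frag_of (a + a', b) - frag_of (a, b) - frag_of (a', b) \<in> tensor_null"
| tn_right: "frag_of (a, b + b') - frag_of (a, b) - frag_of (a, b') \<in> tensor_null"

definition pair_mult ::
  "('a::{ring,monoid_mult} \<times> 'b::{ring,monoid_mult} \<Rightarrow>\<^sub>0 int) \<Rightarrow> ('a \<times> 'b \<Rightarrow>\<^sub>0 int) \<Rightarrow> ('a \<times> 'b \<Rightarrow>\<^sub>0 int)"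
  where "pair_mult x y =
    frag_extend (\<lambda>(a, b). frag_extend (\<lambda>(a', b'). frag_of (a * a', b * b')) y) x"

lemma tn_uminus: "x \<in> tensor_null \<Longrightarrow> - x \<in> tensor_null"
  using tn_diff [OF tn_zero] by simp

lemma tn_add: "x \<in> tensor_null \<Longrightarrow> y \<in> tensor_null \<Longrightarrow> x + y \<in> tensor_null"
  using tn_diff [OF _ tn_uminus, of x y] by simp

lemma pair_mult_of [simp]: "pair_mult (frag_of (a, b)) (frag_of (c, d)) = frag_of (a * c, b * d)"
  by (simp add: pair_mult_def)

lemma pair_mult_diff_left: "pair_mult (x - y) z = pair_mult x z - pair_mult y z"
  by (simp add: pair_mult_def frag_extend_diff)

lemma pair_mult_add_left: "pair_mult (x + y) z = pair_mult x z + pair_mult y z"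
  by (simp add: pair_mult_def frag_extend_add)

lemma pair_mult_0_left [simp]: "pair_mult 0 z = 0"
  by (simp add: pair_mult_def)

lemma pair_mult_0_right [simp]: "pair_mult z 0 = 0"
  by (simp add: pair_mult_def frag_extend_eq_0)

lemma frag_induct [case_names zero one diff]:
  assumes "P 0" "\<And>a b. P (frag_of (a, b))" "\<And>x y. P x \<Longrightarrow> P y \<Longrightarrow> P (x - y)"
  shows "P (x :: 'a \<times> 'b \<Rightarrow>\<^sub>0 int)"
  by (rule frag_induction [of x UNIV]) (use assms in auto)

lemma pair_mult_diff_right: "pair_mult z (x - y) = pair_mult z x - pair_mult z y"
  by (induction z rule: frag_induct)
    (simp_all add: pair_mult_diff_left, simp add: pair_mult_def frag_extend_diff)

lemma pair_mult_add_right: "pair_mult z (x + y) = pair_mult z x + pair_mult z y"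
proof -
  have "pair_mult z (x - (0 - y)) = pair_mult z x - (0 - pair_mult z y)"
    by (simp only: pair_mult_diff_right pair_mult_0_right)
  then show ?thesis by simp
qed

lemma pair_mult_assoc: "pair_mult (pair_mult x y) z = pair_mult x (pair_mult y z)"
proof (induction x rule: frag_induct)
  case (one a b)
  show ?case
  proof (induction y rule: frag_induct)
    case (one c d)
    show ?case
      by (induction z rule: frag_induct) (simp_all add: pair_mult_diff_right mult.assoc)
  qed (simp_all add: pair_mult_diff_right pair_mult_diff_left)
qed (simp_all add: pair_mult_diff_left)

lemma pair_mult_one_left: "pair_mult (frag_of (1, 1)) x = x"
  by (induction x rule: frag_induct) (simp_all add: pair_mult_diff_right)

lemma pair_mult_one_right: "pair_mult x (frag_of (1, 1)) = x"
  by (induction x rule: frag_induct) (simp_all add: pair_mult_diff_left)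

lemma pair_mult_null_left: "x \<in> tensor_null \<Longrightarrow> pair_mult x z \<in> tensor_null"
proof (induction z rule: frag_induct)
  case (one c d)
  then show ?case
  proof (induction x rule: tensor_null.induct)
    case (tn_left a a' b)
    then show ?case
      using tensor_null.tn_left [of "a * c" "a' * c" "b * d"]
      by (simp add: pair_mult_diff_left distrib_right)
  next
    case (tn_right a b b')
    then show ?case
      using tensor_null.tn_right [of "a * c" "b * d" "b' * d"]
      by (simp add: pair_mult_diff_left distrib_right)
  qed (simp_all add: pair_mult_diff_left tensor_null.intros)
qed (simp_all add: pair_mult_diff_right tensor_null.intros)

lemma pair_mult_null_right: "x \<in> tensor_null \<Longrightarrow> pair_mult z x \<in> tensor_null"
proof (induction z rule: frag_induct)
  case (one c d)
  then show ?case
  proof (induction x rule: tensor_null.induct)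
    case (tn_left a a' b)
    then show ?case
      using tensor_null.tn_left [of "c * a" "c * a'" "d * b"]
      by (simp add: pair_mult_diff_right distrib_left)
  next
    case (tn_right a b b')
    then show ?case
      using tensor_null.tn_right [of "c * a" "d * b" "d * b'"]
      by (simp add: pair_mult_diff_right distrib_left)
  qed (simp_all add: pair_mult_diff_right tensor_null.intros)
qed (simp_all add: pair_mult_diff_left tensor_null.intros)

definition tensor_eq ::
  "('a::{ring,monoid_mult} \<times> 'b::{ring,monoid_mult} \<Rightarrow>\<^sub>0 int) \<Rightarrow> ('a \<times> 'b \<Rightarrow>\<^sub>0 int) \<Rightarrow> bool"
  where "tensor_eq x y \<longleftrightarrow> x - y \<in> tensor_null"

lemma equivp_tensor_eq: "equivp tensor_eq"
proof (rule equivpI)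
  show "reflp tensor_eq"
    by (simp add: reflp_def tensor_eq_def tn_zero)
  show "symp tensor_eq"
    by (rule sympI) (unfold tensor_eq_def, drule tn_uminus, simp)
  show "transp tensor_eq"
    by (rule transpI) (unfold tensor_eq_def, drule (1) tn_add, simp)
qed

quotient_type (overloaded) ('a, 'b) tensor = "'a::{ring,monoid_mult} \<times> 'b::{ring,monoid_mult} \<Rightarrow>\<^sub>0 int" / tensor_eq
  by (rule equivp_tensor_eq)

instantiation tensor :: ("{ring,monoid_mult}", "{ring,monoid_mult}") "{ring, monoid_mult}"
begin

lift_definition zero_tensor :: "('a, 'b) tensor" is 0 .

lift_definition one_tensor :: "('a, 'b) tensor" is "frag_of (1, 1)" .

lift_definition plus_tensor :: "('a, 'b) tensor \<Rightarrow> ('a, 'b) tensor \<Rightarrow> ('a, 'b) tensor" is "(+)"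
  unfolding tensor_eq_def by (drule (1) tn_add) (simp add: add_diff_add)

lift_definition uminus_tensor :: "('a, 'b) tensor \<Rightarrow> ('a, 'b) tensor" is uminus
  unfolding tensor_eq_def by (drule tn_uminus) (simp only: minus_diff_eq minus_diff_minus)

lift_definition times_tensor :: "('a, 'b) tensor \<Rightarrow> ('a, 'b) tensor \<Rightarrow> ('a, 'b) tensor" is pair_mult
proof -
  fix x x' y y' :: "'a \<times> 'b \<Rightarrow>\<^sub>0 int"
  assume "tensor_eq x x'" "tensor_eq y y'"
  then have "pair_mult (x - x') y + pair_mult x' (y - y') \<in> tensor_null"
    by (auto simp: tensor_eq_def intro: tn_add pair_mult_null_left pair_mult_null_right)
  then show "tensor_eq (pair_mult x y) (pair_mult x' y')"
    by (simp add: tensor_eq_def pair_mult_diff_left pair_mult_diff_right)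
qed

definition minus_tensor :: "('a, 'b) tensor \<Rightarrow> ('a, 'b) tensor \<Rightarrow> ('a, 'b) tensor"
  where "minus_tensor x y = x + - y"

lemma tensor_eq_refl: "x = y \<Longrightarrow> tensor_eq x y"
  by (simp add: tensor_eq_def tn_zero)

instance
proof
  fix a b c :: "('a, 'b) tensor"
  show "a + b + c = a + (b + c)" by transfer (simp add: tensor_eq_refl add.assoc)
  show "a + b = b + a" by transfer (simp add: tensor_eq_refl add.commute)
  show "0 + a = a" by transfer (simp add: tensor_eq_refl)
  show "- a + a = 0" by transfer (simp add: tensor_eq_refl)
  show "a - b = a + - b" by (rule minus_tensor_def)
  show "a * b * c = a * (b * c)" by transfer (simp add: tensor_eq_refl pair_mult_assoc)
  show "(a + b) * c = a * c + b * c" by transfer (simp add: tensor_eq_refl pair_mult_add_left)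
  show "a * (b + c) = a * b + a * c" by transfer (simp add: tensor_eq_refl pair_mult_add_right)
  show "1 * a = a" by transfer (simp add: tensor_eq_refl pair_mult_one_left)
  show "a * 1 = a" by transfer (simp add: tensor_eq_refl pair_mult_one_right)
qed

end

lift_definition tensor_of :: "'a::{ring,monoid_mult} \<Rightarrow> 'b::{ring,monoid_mult} \<Rightarrow> ('a, 'b) tensor"
  (infixr "\<otimes>" 75) is "\<lambda>a b. frag_of (a, b)" .

definition tscale :: "'k::field \<Rightarrow> ('a::{ring,monoid_mult}, 'k) tensor \<Rightarrow> ('a, 'k) tensor"
  where "tscale c x = (1 \<otimes> c) * x"


section \<open>The $p$-part of the BC-algebra\<close>

text \<open>The canonical map from the group algebra of $\mathbb{Q}/\mathbb{Z}$ over \<open>'k\<close>.\<close>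

definition grp_alg :: "(qz \<Rightarrow>\<^sub>0 'k::field) \<Rightarrow> (bc, 'k) tensor"
  where "grp_alg x = (\<Sum>r\<in>Poly_Mapping.keys x. bc_grp (frag_of r) \<otimes> Poly_Mapping.lookup x r)"

definition qz_p :: "nat \<Rightarrow> qz set"
  where "qz_p p = {qz_of (of_int k / of_nat p ^ l) | k l. True}"

definition A_pinf :: "nat \<Rightarrow> (qz \<Rightarrow>\<^sub>0 'k::field) set"
  where "A_pinf p = {x. Poly_Mapping.keys x \<subseteq> qz_p p}"

inductive_set subalgebra_gen ::
    "('a::{ring,monoid_mult}, 'k::field) tensor set \<Rightarrow> ('a, 'k) tensor set"
  for G where
  sg_gen: "x \<in> G \<Longrightarrow> x \<in> subalgebra_gen G"
| sg_one: "1 \<in> subalgebra_gen G"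
| sg_add: "x \<in> subalgebra_gen G \<Longrightarrow> y \<in> subalgebra_gen G \<Longrightarrow> x + y \<in> subalgebra_gen G"
| sg_mult: "x \<in> subalgebra_gen G \<Longrightarrow> y \<in> subalgebra_gen G \<Longrightarrow> x * y \<in> subalgebra_gen G"
| sg_scale: "x \<in> subalgebra_gen G \<Longrightarrow> tscale c x \<in> subalgebra_gen G"

definition mu_tilde_p :: "nat \<Rightarrow> (bc, 'k::field) tensor"
  where "mu_tilde_p p = mu_tilde (num_of_nat p) \<otimes> 1"

definition mu_star_p :: "nat \<Rightarrow> (bc, 'k::field) tensor"
  where "mu_star_p p = mu_star (num_of_nat p) \<otimes> 1"

definition C_p :: "nat \<Rightarrow> (bc, 'k::field) tensor set"
  where "C_p p = subalgebra_gen (grp_alg ` A_pinf p \<union> {mu_tilde_p p, mu_star_p p})"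

text \<open>
  For \<open>p\<close> the characteristic, the value does not depend on the representation of \<open>a\<close> as
  $k/p^l$; see the lemma below.
\<close>

definition delta :: "nat \<Rightarrow> real \<Rightarrow> qz \<Rightarrow>\<^sub>0 'k::field"
  where "delta p a = (THE x. \<forall>k l. a = of_nat k / of_nat p ^ l \<longrightarrow> x = (1 - e_QZ (1 / of_nat p ^ l)) ^ k)"

lemma e_power: "e_QZ r ^ n = (e_QZ (of_nat n * r) :: qz \<Rightarrow>\<^sub>0 'k::comm_ring_1)"
proof (induction n)
  case 0
  show ?case by (simp add: e_QZ_def zero_qz.abs_eq [symmetric])
next
  case (Suc n)
  then show ?case
    by (simp add: e_QZ_def mult_single plus_qz.abs_eq algebra_simps)
qed

lemma CHAR_group_algebra: "CHAR(qz \<Rightarrow>\<^sub>0 'k::field) = CHAR('k)"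
proof (rule CHAR_eqI)
  show "of_nat CHAR('k) = (0 :: qz \<Rightarrow>\<^sub>0 'k)"
    by (metis of_nat_CHAR single_of_nat single_zero)
next
  fix n assume "of_nat n = (0 :: qz \<Rightarrow>\<^sub>0 'k)"
  then have "of_nat n = (0 :: 'k)"
    by (metis lookup_single_eq lookup_zero single_of_nat)
  then show "CHAR('k) dvd n" by (simp add: of_nat_eq_0_iff_char_dvd)
qed

lemma one_minus_e_step:
  assumes "prime p" "CHAR('k::field) = p"
  shows "(1 - e_QZ (1 / of_nat p ^ (l + m))) ^ (p ^ m) = (1 - e_QZ (1 / of_nat p ^ l) :: qz \<Rightarrow>\<^sub>0 'k)"
proof -
  have "(x + y) ^ (p ^ m) = x ^ (p ^ m) + y ^ (p ^ m)" for x y :: "qz \<Rightarrow>\<^sub>0 'k"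
    using freshmans_dream' [of "p ^ m" m x y] assms by (simp add: CHAR_group_algebra)
  from this [of "1 - e_QZ (1 / of_nat p ^ (l + m))" "e_QZ (1 / of_nat p ^ (l + m))"]
  have "1 = (1 - e_QZ (1 / of_nat p ^ (l + m))) ^ (p ^ m)
      + (e_QZ (1 / of_nat p ^ (l + m)) ^ (p ^ m) :: qz \<Rightarrow>\<^sub>0 'k)"
    by simp
  moreover have "of_nat (p ^ m) * (1 / of_nat p ^ (l + m)) = (1 / of_nat p ^ l :: rat)"
    using assms(1) by (simp add: power_add prime_gt_0_nat)
  ultimately show ?thesis by (simp add: e_power algebra_simps)
qed

lemma delta_eq:
  assumes "prime p" "CHAR('k::field) = p"
  shows "delta p (of_nat k / of_nat p ^ l) = ((1 - e_QZ (1 / of_nat p ^ l)) ^ k :: qz \<Rightarrow>\<^sub>0 'k)"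
proof -
  have unique: "(1 - e_QZ (1 / of_nat p ^ l)) ^ k = ((1 - e_QZ (1 / of_nat p ^ l')) ^ k' :: qz \<Rightarrow>\<^sub>0 'k)"
    if "real k / real p ^ l = real k' / real p ^ l'" for k' l'
  proof -
    have p0: "p \<noteq> 0" using assms(1) by auto
    have "real (k * p ^ l') = real (k' * p ^ l)"
      using that p0 by (simp add: field_simps)
    then have eq: "p ^ l' * k = p ^ l * k'"
      by (simp only: of_nat_eq_iff mult.commute)
    show ?thesis
      using one_minus_e_step [OF assms, of l l'] one_minus_e_step [OF assms, of l' l] eq
      by (metis add.commute power_mult)
  qed
  show ?thesis
    unfolding delta_def by (rule the_equality) (blast intro: unique, blast)
qed


section \<open>The representation space\<close>

definition S_set :: "nat \<Rightarrow> real set"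
  where "S_set p = (\<Union>n. {of_int k / of_nat p ^ n | k. True})"

definition S01 :: "nat \<Rightarrow> real set"
  where "S01 p = S_set p \<inter> {0..<1}"

definition V_space :: "nat \<Rightarrow> (real \<Rightarrow>\<^sub>0 'k::field) set"
  where "V_space p = {f. Poly_Mapping.keys f \<subseteq> S01 p}"

definition vscale :: "'k::field \<Rightarrow> (real \<Rightarrow>\<^sub>0 'k) \<Rightarrow> (real \<Rightarrow>\<^sub>0 'k)"
  where "vscale c f = Poly_Mapping.map ((*) c) f"

definition xi :: "real \<Rightarrow> real \<Rightarrow>\<^sub>0 'k::field"
  where "xi a = (if a < 1 then Poly_Mapping.single a 1 else 0)"

text \<open>
  Endomorphisms are extensional functions on \<open>V_space p\<close>, so that equality of functions is equality
  of endomorphisms.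
\<close>

definition End_V :: "nat \<Rightarrow> ((real \<Rightarrow>\<^sub>0 'k::field) \<Rightarrow> (real \<Rightarrow>\<^sub>0 'k)) set"
  where "End_V p = {T \<in> V_space p \<rightarrow>\<^sub>E V_space p.
    (\<forall>f\<in>V_space p. \<forall>g\<in>V_space p. T (f + g) = T f + T g) \<and>
    (\<forall>c. \<forall>f\<in>V_space p. T (vscale c f) = vscale c (T f))}"

definition is_representation ::
    "nat \<Rightarrow> ((bc, 'k::field) tensor \<Rightarrow> (real \<Rightarrow>\<^sub>0 'k) \<Rightarrow> (real \<Rightarrow>\<^sub>0 'k)) \<Rightarrow> bool"
  where "is_representation p \<theta> \<longleftrightarrow>
    \<theta> \<in> C_p p \<rightarrow> End_V p \<and>
    (\<forall>f\<in>V_space p. \<theta> 1 f = f) \<and>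
    (\<forall>x\<in>C_p p. \<forall>y\<in>C_p p. \<forall>f\<in>V_space p. \<theta> (x + y) f = \<theta> x f + \<theta> y f) \<and>
    (\<forall>x\<in>C_p p. \<forall>y\<in>C_p p. \<forall>f\<in>V_space p. \<theta> (x * y) f = \<theta> x (\<theta> y f)) \<and>
    (\<forall>c. \<forall>x\<in>C_p p. \<forall>f\<in>V_space p. \<theta> (tscale c x) f = vscale c (\<theta> x f))"

definition theta_equations ::
    "nat \<Rightarrow> ((bc, 'k::field) tensor \<Rightarrow> (real \<Rightarrow>\<^sub>0 'k) \<Rightarrow> (real \<Rightarrow>\<^sub>0 'k)) \<Rightarrow> bool"
  where "theta_equations p \<theta> \<longleftrightarrow>
    (\<forall>a\<in>S01 p. \<forall>b\<in>S01 p. \<theta> (grp_alg (delta p b)) (xi a) = xi (a + b)) \<and>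
    (\<forall>a\<in>S01 p. \<theta> (mu_tilde_p p) (xi a) = xi ((a + of_nat p - 1) / of_nat p)) \<and>
    (\<forall>a\<in>S01 p. \<theta> (mu_star_p p) (xi a) = xi (of_nat p * a))"

definition is_matrix_of ::
    "nat \<Rightarrow> (real \<Rightarrow> real \<Rightarrow> 'k::field) \<Rightarrow> ((real \<Rightarrow>\<^sub>0 'k) \<Rightarrow> (real \<Rightarrow>\<^sub>0 'k)) \<Rightarrow> bool"
  where "is_matrix_of p M T \<longleftrightarrow> (\<forall>f\<in>V_space p. \<forall>a\<in>S01 p.
    Poly_Mapping.lookup (T f) a = (\<Sum>b\<in>Poly_Mapping.keys f. M a b * Poly_Mapping.lookup f b))"

definition lower_triangular :: "nat \<Rightarrow> (real \<Rightarrow> real \<Rightarrow> 'k::field) \<Rightarrow> bool"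
  where "lower_triangular p M \<longleftrightarrow> (\<forall>a\<in>S01 p. \<forall>b\<in>S01 p. \<not> a \<ge> b \<longrightarrow> M a b = 0)"

end

theory Submission
  imports Defs
begin

text \<open>
  The algebra $\mathcal{A}_{\mathbb{Z}} \otimes \mathbb{K}$ acts on $\mathbb{K}[\mathbb{Q}/\mathbb{Z}]$: the group ring by
  multiplication, $\tilde\mu_n$ by $\tilde\rho_n$ and $\mu_n^*$ by $\sigma_n$. The $p$-part preserves
  $A_{p^\infty}$, and \<open>\<theta>\<close> is this action transported along the bijection $\xi_a \mapsto \delta_a$, because
  $\sigma_p(\delta_a) = \delta_{pa}$ and $\tilde\rho_p(\delta_a) = \delta_{a/p}\,\tilde\rho_p(1)$ with
  $\tilde\rho_p(1) = \sum_{j<p} e(j/p) = (1 - e(1/p))^{p-1}$.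

  For faithfulness, $\mu_p^* \tilde\mu_p = p = 0$ lets one write every element of the $p$-part as a linear
  combination of the words $\tilde\mu_p^n \delta_b$ and $\delta_b (\mu_p^*)^n$. A word sends $\delta_a$ to
  $\delta_{g(a)}$ for an affine map $g$ that determines the word, and finitely many distinct affine maps
  take distinct values at a suitable small $a$.
\<close>

section \<open>Additive extension of maps on monomials\<close>

text \<open>Generators and relations give no way to see that an element of \<open>bc\<close> is
  nonzero; the action is the concrete model that detects it. It lives on the whole group algebra of
  Q/Z because the relations of \<open>bc\<close> involve every positive integer, not only powers of
  \<open>p\<close>. Most of them reduce to how fibres of multiplication by \<open>n\<close> on Q/Z
  behave under translation, composition and multiplication by a coprime number.

  The words span the \<open>p\<close>-part by rewriting alone, and no basis property is assumed:
  their independence is read off from the action. The obstacle there is truncation. Since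
  \<open>delta p c = 0\<close> for \<open>c \<ge> 1\<close>, a word may kill a basis vector, and two
  affine maps may meet at a point. Near 0 neither happens: at 0 the maps have the values
  \<open>b\<close> or \<open>1 - (1 - b) / p^n\<close> with \<open>b < 1\<close>, which stay below
  1, and two distinct affine maps meet at most once.\<close>

lemma poly_mapping_induct [consumes 1, case_names zero single add]:
  assumes "Poly_Mapping.keys x \<subseteq> A"
    and "P 0" "\<And>r c. r \<in> A \<Longrightarrow> P (Poly_Mapping.single r c)"
    and "\<And>x y. P x \<Longrightarrow> P y \<Longrightarrow> P (x + y)"
  shows "P (x :: 'a \<Rightarrow>\<^sub>0 'c::comm_monoid_add)"
proof -
  have "P (\<Sum>r\<in>I. Poly_Mapping.single r (Poly_Mapping.lookup x r))" if "finite I" "I \<subseteq> A" for I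
    using that by (induction I rule: finite_induct) (auto intro: assms)
  moreover have "(\<Sum>r\<in>Poly_Mapping.keys x. Poly_Mapping.single r (Poly_Mapping.lookup x r)) = x"
  proof (rule poly_mapping_eqI)
    fix k
    have "(\<Sum>r\<in>Poly_Mapping.keys x. Poly_Mapping.lookup x r when r = k) = Poly_Mapping.lookup x k"
      by (cases "k \<in> Poly_Mapping.keys x") (simp_all add: when_def in_keys_iff)
    then show "Poly_Mapping.lookup (\<Sum>r\<in>Poly_Mapping.keys x. Poly_Mapping.single r (Poly_Mapping.lookup x r)) k
        = Poly_Mapping.lookup x k"
      by (simp add: lookup_sum lookup_single)
  qed
  ultimately show ?thesis using assms(1) by (metis finite_keys)
qed

text \<open>Coefficients enter through an arbitrary function instead of a scalar multiplication,
  because source and target may have different coefficient rings: integers to \<open>'k\<close> in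
  \<open>gint\<close>, \<open>'k\<close> to a tensor product in \<open>comb\<close>.\<close>

definition lext :: "('a \<Rightarrow> 'c::zero \<Rightarrow> 'm::comm_monoid_add) \<Rightarrow> ('a \<Rightarrow>\<^sub>0 'c) \<Rightarrow> 'm"
  where "lext G x = (\<Sum>r\<in>Poly_Mapping.keys x. G r (Poly_Mapping.lookup x r))"

lemma lext_single:
  assumes "additive (G r)"
  shows "lext G (Poly_Mapping.single r c) = G r c"
  using additive.zero [OF assms] by (simp add: lext_def)

lemma additive_lext:
  fixes G :: "'a \<Rightarrow> 'c::ab_group_add \<Rightarrow> 'm::ab_group_add"
  assumes "\<And>r. additive (G r)"
  shows "additive (lext G)"
proof
  fix x y :: "'a \<Rightarrow>\<^sub>0 'c"
  let ?K = "Poly_Mapping.keys x \<union> Poly_Mapping.keys y"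
  \<comment> \<open>Cancellation can shrink the support of a sum, so all three sums are taken over
    one common set; the extra terms are \<open>G r 0 = 0\<close>.\<close>
  have *: "lext G z = (\<Sum>r\<in>?K. G r (Poly_Mapping.lookup z r))" if "Poly_Mapping.keys z \<subseteq> ?K" for z
    unfolding lext_def using that
    by (intro sum.mono_neutral_left) (auto simp: in_keys_iff additive.zero [OF assms])
  show "lext G (x + y) = lext G x + lext G y"
    using keys_add [of x y]
    by (simp add: * lookup_add additive.add [OF assms] sum.distrib)
qed

lemma additive_eqI:
  fixes F :: "('a \<Rightarrow>\<^sub>0 'c::ab_group_add) \<Rightarrow> 'm::ab_group_add"
  assumes "additive F" "additive F'"
    and "\<And>r c. r \<in> A \<Longrightarrow> F (Poly_Mapping.single r c) = F' (Poly_Mapping.single r c)"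
    and "Poly_Mapping.keys x \<subseteq> A"
  shows "F x = F' x"
  using assms(4)
  by (induction x rule: poly_mapping_induct)
    (simp_all add: assms(3) additive.zero [OF assms(1)] additive.zero [OF assms(2)]
      additive.add [OF assms(1)] additive.add [OF assms(2)])

lemmas additive_eqI_UNIV = additive_eqI [where A = UNIV, OF _ _ _ subset_UNIV]

lemma additive_ident: "additive (\<lambda>x. x)"
  by (simp add: additive_def)

lemma additive_const_mult: "additive (\<lambda>x. a * F x)" if "additive F" for a :: "'a::ring"
  using that by (simp add: additive_def distrib_left)

lemma additive_mult_const: "additive (\<lambda>x. F x * a)" if "additive F" for a :: "'a::ring"
  using that by (simp add: additive_def distrib_right)

lemma additive_sum: "additive (\<lambda>x. \<Sum>i\<in>I. F i x)" if "\<And>i. additive (F i)"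
  using that by (simp add: additive_def sum.distrib)

lemma additive_comp: "additive (\<lambda>x. F (G x))" if "additive F" "additive G"
  using that by (simp add: additive_def)

lemma additive_single: "additive (Poly_Mapping.single r)"
  by (simp add: additive_def single_add)

lemma additive_of_int: "additive of_int"
  by (simp add: additive_def)

text \<open>Composition is included only with a fixed outer map; with both maps schematic the rule
  would match every goal.\<close>

lemmas additive_intros = additive_ident additive_const_mult additive_mult_const additive_sum
  additive_single additive_of_int additive_comp [OF additive_single]


section \<open>Multiplication by $n$ on $\mathbb{Q}/\mathbb{Z}$\<close>

lemma qz_of_eq_iff: "qz_of x = qz_of y \<longleftrightarrow> x - y \<in> \<int>"
  by (simp add: qz.abs_eq_iff)

lemma qz_of_cases: obtains x where "r = qz_of x"
  using that [of "rep_qz r"] Quotient3_abs_rep [OF Quotient3_qz] by metis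

lemma qz_times_of: "qz_times n (qz_of x) = qz_of (of_nat n * x)"
  by (rule qz_times.abs_eq)

lemma qz_of_add: "qz_of (x + y) = qz_of x + qz_of y"
  by (simp add: plus_qz.abs_eq)

lemma qz_of_zero: "qz_of 0 = 0"
  by (simp add: zero_qz.abs_eq)

lemma qz_times_add: "qz_times n (r + s) = qz_times n r + qz_times n s"
  by (cases r rule: qz_of_cases; cases s rule: qz_of_cases)
    (simp add: qz_times_of plus_qz.abs_eq distrib_left)

lemma additive_qz_times: "additive (qz_times n)"
  by (simp add: additive_def qz_times_add)

lemma qz_times_qz_times: "qz_times n (qz_times m r) = qz_times (n * m) r"
  by (cases r rule: qz_of_cases) (simp add: qz_times_of mult.assoc)

text \<open>Two listed roots differ by \<open>(i - j) / n\<close>, an integer only if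
  \<open>n\<close> divides \<open>i - j\<close>. Conversely, if \<open>n * y - x = k\<close>,
  subtracting the integer \<open>k div n\<close> from \<open>y\<close> leaves the root with index
  \<open>k mod n\<close>.\<close>

lemma qz_roots:
  assumes "n > 0"
  shows "{s. qz_times n s = qz_of x} = (\<lambda>j. qz_of ((x + of_nat j) / of_nat n)) ` {..<n}"
    and "inj_on (\<lambda>j. qz_of ((x + of_nat j) / of_nat n)) {..<n}"
proof -
  show "inj_on (\<lambda>j. qz_of ((x + of_nat j) / of_nat n)) {..<n}"
  proof
    fix i j assume ij: "i \<in> {..<n}" "j \<in> {..<n}"
      and "qz_of ((x + of_nat i) / of_nat n) = qz_of ((x + of_nat j) / of_nat n)"
    then have "(x + of_nat i) / of_nat n - (x + of_nat j) / of_nat n \<in> \<int>"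
      by (simp add: qz_of_eq_iff)
    then obtain k where "(x + of_nat i) / of_nat n - (x + of_nat j) / of_nat n = of_int k"
      by (elim Ints_cases)
    then have "((x + of_nat i) / of_nat n - (x + of_nat j) / of_nat n) * of_nat n = of_int k * (of_nat n :: rat)"
      by simp
    then have "of_int (int i - int j) = (of_int (int n * k) :: rat)"
      using assms by (simp add: left_diff_distrib)
    then have eq: "int i - int j = int n * k"
      by (simp only: of_int_eq_iff)
    then have "int n dvd int i - int j" by simp
    then show "i = j"
      using ij by (metis lessThan_iff mod_eq_dvd_iff mod_less of_nat_eq_iff zmod_int)
  qed
  show "{s. qz_times n s = qz_of x} = (\<lambda>j. qz_of ((x + of_nat j) / of_nat n)) ` {..<n}"
  proof (intro equalityI subsetI)
    fix s assume "s \<in> {s. qz_times n s = qz_of x}"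
    moreover obtain y where s: "s = qz_of y" by (cases s rule: qz_of_cases)
    ultimately have "of_nat n * y - x \<in> \<int>" by (simp add: qz_times_of qz_of_eq_iff)
    then obtain k where k: "of_nat n * y - x = of_int k" by (elim Ints_cases)
    define j where "j = nat (k mod int n)"
    have "int j = k - int n * (k div int n)"
      using assms by (simp add: j_def minus_mult_div_eq_mod)
    then have "(of_nat j :: rat) = of_int k - of_nat n * of_int (k div int n)"
      by (metis of_int_diff of_int_mult of_int_of_nat_eq)
    then have "y - (x + of_nat j) / of_nat n = of_int (k div int n)"
      using assms k by (simp add: field_simps)
    then have "s = qz_of ((x + of_nat j) / of_nat n)"
      by (simp add: s qz_of_eq_iff)
    moreover have "j < n" using assms by (simp add: j_def nat_less_iff)
    ultimately show "s \<in> (\<lambda>j. qz_of ((x + of_nat j) / of_nat n)) ` {..<n}" by blast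
  next
    fix s assume "s \<in> (\<lambda>j. qz_of ((x + of_nat j) / of_nat n)) ` {..<n}"
    then obtain j where "s = qz_of ((x + of_nat j) / of_nat n)" by blast
    then show "s \<in> {s. qz_times n s = qz_of x}"
      using assms by (simp add: qz_times_of qz_of_eq_iff)
  qed
qed

lemma card_qz_roots: "n > 0 \<Longrightarrow> card {s. qz_times n s = r} = n"
  by (cases r rule: qz_of_cases) (simp add: qz_roots card_image)

lemma finite_qz_roots: "n > 0 \<Longrightarrow> finite {s. qz_times n s = r}"
  by (cases r rule: qz_of_cases) (simp add: qz_roots)

text \<open>Bezout: a difference killed by \<open>n\<close> and by \<open>m\<close> is killed by
  \<open>u * n + v * m = 1\<close>.\<close>

lemma qz_times_coprime_inj:
  assumes "coprime n m" "qz_times n s = qz_times n t" "qz_times m s = qz_times m t"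
  shows "s = t"
proof -
  obtain x y where s: "s = qz_of x" and t: "t = qz_of y" by (metis qz_of_cases)
  have n: "of_nat n * (x - y) \<in> \<int>" and m: "of_nat m * (x - y) \<in> \<int>"
    using assms(2,3) by (simp_all add: s t qz_times_of qz_of_eq_iff right_diff_distrib)
  obtain u v where "u * int n + v * int m = 1"
    using assms(1) by (metis bezout_int coprime_iff_gcd_eq_1 coprime_int_iff)
  then have "of_int u * of_nat n + of_int v * of_nat m = (1 :: rat)"
    by (metis of_int_1 of_int_add of_int_mult of_int_of_nat_eq)
  then have "x - y = of_int u * (of_nat n * (x - y)) + of_int v * (of_nat m * (x - y))"
    by (metis distrib_right mult.assoc mult_1)
  also have "\<dots> \<in> \<int>" by (intro Ints_add Ints_mult n m) auto
  finally show ?thesis by (simp add: s t qz_of_eq_iff)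
qed

text \<open>The fibres of multiplication by \<open>n\<close> are cosets of one kernel, so
  translation by \<open>t\<close> permutes them. This drives the projection formula
  \<open>grho_gsigma_mult\<close>.\<close>

lemma qz_roots_shift:
  assumes "n > 0" "qz_times n t = r"
  shows "bij_betw ((+) t) {s. qz_times n s = r'} {s. qz_times n s = r + r'}"
proof (rule bij_betw_byWitness [where f' = "\<lambda>s. s - t"])
  show "(\<lambda>s. s - t) ` {s. qz_times n s = r + r'} \<subseteq> {s. qz_times n s = r'}"
    using assms by (auto simp: additive.diff [OF additive_qz_times])
qed (use assms in \<open>auto simp: qz_times_add\<close>)

text \<open>Injectivity comes from coprimality; both fibres have \<open>n\<close> elements, so
  surjectivity follows by counting.\<close>

lemma qz_roots_coprime:
  assumes "n > 0" "coprime n m"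
  shows "bij_betw (qz_times m) {s. qz_times n s = r} {s. qz_times n s = qz_times m r}"
proof -
  have inj: "inj_on (qz_times m) {s. qz_times n s = r}"
    using assms by (auto intro!: inj_onI intro: qz_times_coprime_inj)
  moreover have "qz_times m ` {s. qz_times n s = r} \<subseteq> {s. qz_times n s = qz_times m r}"
    by (auto simp: qz_times_qz_times mult.commute)
  ultimately show ?thesis
    using assms by (simp add: bij_betw_def card_subset_eq finite_qz_roots card_image card_qz_roots)
qed

section \<open>The action of the integral BC-algebra on the group algebra\<close>

text \<open>Counterparts of \<open>sigma\<close> and \<open>rho\<close> over an arbitrary
  commutative ring, since the action takes place over \<open>'k\<close>; \<open>gint\<close> is the
  change of coefficients that links them to the integral versions.\<close>

definition gsigma :: "nat \<Rightarrow> (qz \<Rightarrow>\<^sub>0 'k::comm_ring_1) \<Rightarrow> (qz \<Rightarrow>\<^sub>0 'k)"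
  where "gsigma n = lext (\<lambda>r. Poly_Mapping.single (qz_times n r))"

definition grho :: "nat \<Rightarrow> (qz \<Rightarrow>\<^sub>0 'k::comm_ring_1) \<Rightarrow> (qz \<Rightarrow>\<^sub>0 'k)"
  where "grho n = lext (\<lambda>r c. \<Sum>s | qz_times n s = r. Poly_Mapping.single s c)"

definition gint :: "(qz \<Rightarrow>\<^sub>0 int) \<Rightarrow> (qz \<Rightarrow>\<^sub>0 'k::comm_ring_1)"
  where "gint = lext (\<lambda>r c. Poly_Mapping.single r (of_int c))"

lemma additive_gsigma: "additive (gsigma n)"
  unfolding gsigma_def by (intro additive_lext additive_single)

lemma additive_grho: "additive (grho n)"
  unfolding grho_def by (intro additive_lext additive_intros)

lemma additive_gint: "additive gint"
  unfolding gint_def by (intro additive_lext additive_intros)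

lemma gsigma_single: "gsigma n (Poly_Mapping.single r c) = Poly_Mapping.single (qz_times n r) c"
  by (simp add: gsigma_def lext_single additive_single)

lemma grho_single:
  "grho n (Poly_Mapping.single r c) = (\<Sum>s | qz_times n s = r. Poly_Mapping.single s c)"
  unfolding grho_def by (intro lext_single additive_intros)

lemma gint_single: "gint (Poly_Mapping.single r c) = Poly_Mapping.single r (of_int c)"
  unfolding gint_def by (intro lext_single additive_intros)

lemmas group_algebra_intros = additive_intros additive_gsigma additive_grho additive_gint
  additive_comp [OF additive_gsigma] additive_comp [OF additive_grho] additive_comp [OF additive_gint]

lemma gsigma_mult: "gsigma n (x * y) = gsigma n x * gsigma n y"
proof (rule additive_eqI_UNIV [of "\<lambda>x. gsigma n (x * y)"])
  fix r :: qz and c :: 'a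
  show "gsigma n (Poly_Mapping.single r c * y) = gsigma n (Poly_Mapping.single r c) * gsigma n y"
    by (rule additive_eqI_UNIV; (intro group_algebra_intros)?)
      (simp add: gsigma_single mult_single qz_times_add)
qed (intro group_algebra_intros)+

lemma gsigma_one: "gsigma n 1 = 1"
  using gsigma_single [of n 0 1] by (simp add: additive.zero [OF additive_qz_times])

lemma gsigma_power: "gsigma n (x ^ k) = gsigma n x ^ k"
  by (induction k) (simp_all add: gsigma_one gsigma_mult)

lemma gint_mult: "gint (x * y) = gint x * gint y"
proof (rule additive_eqI_UNIV [of "\<lambda>x. gint (x * y)"])
  fix r c
  show "gint (Poly_Mapping.single r c * y) = gint (Poly_Mapping.single r c) * gint y"
    by (rule additive_eqI_UNIV; (intro group_algebra_intros)?)
      (simp add: gint_single mult_single)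
qed (intro group_algebra_intros)+

lemma gint_one: "gint 1 = 1"
  using gint_single [of 0 1] by simp

lemma gint_of_nat: "gint (of_nat n) = of_nat n"
  using gint_single [of 0 "int n"] by simp

text \<open>The source of both defining relations that involve $\tilde\mu_n$ and the group ring.\<close>

lemma grho_gsigma_mult:
  assumes "n > 0"
  shows "grho n (gsigma n x * y) = x * grho n y"
proof (rule additive_eqI_UNIV [of "\<lambda>x. grho n (gsigma n x * y)"])
  fix t :: qz and c :: 'a
  show "grho n (gsigma n (Poly_Mapping.single t c) * y) = Poly_Mapping.single t c * grho n y"
  proof (rule additive_eqI_UNIV [of "\<lambda>y. grho n (gsigma n (Poly_Mapping.single t c) * y)"])
    fix r :: qz and d :: 'a
    have "(\<Sum>s | qz_times n s = r. Poly_Mapping.single (t + s) (c * d))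
        = (\<Sum>s | qz_times n s = qz_times n t + r. Poly_Mapping.single s (c * d))"
      using sum.reindex_bij_betw [OF qz_roots_shift [OF assms refl]] by fastforce
    then show "grho n (gsigma n (Poly_Mapping.single t c) * Poly_Mapping.single r d)
        = Poly_Mapping.single t c * grho n (Poly_Mapping.single r d)"
      by (simp add: gsigma_single grho_single mult_single sum_distrib_left)
  qed (intro group_algebra_intros)+
qed (intro group_algebra_intros)+

lemma grho_mult_gsigma: "n > 0 \<Longrightarrow> grho n (x * gsigma n y) = grho n x * y"
  by (metis grho_gsigma_mult mult.commute)

lemma gint_sigma: "gint (sigma n f) = gsigma n (gint f)"
  unfolding sigma_def
  by (induction f rule: frag_induction [OF subset_UNIV])
    (simp_all add: frag_extend_diff additive.zero [OF additive_gint] additive.zero [OF additive_gsigma]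
      additive.diff [OF additive_gint] additive.diff [OF additive_gsigma] gint_single gsigma_single)

lemma gint_rho: "gint (rho n f) = grho n (gint f)"
  unfolding rho_def
  by (induction f rule: frag_induction [OF subset_UNIV])
    (simp_all add: frag_extend_diff additive.zero [OF additive_gint] additive.zero [OF additive_grho]
      additive.diff [OF additive_gint] additive.diff [OF additive_grho] gint_single grho_single
      additive.sum [OF additive_gint])

lemma gsigma_gsigma: "gsigma n (gsigma m x) = gsigma (n * m) x"
  by (rule additive_eqI_UNIV; (intro group_algebra_intros)?)
    (simp add: gsigma_single qz_times_qz_times)

lemma grho_grho:
  assumes "n > 0" "m > 0"
  shows "grho n (grho m x) = grho (n * m) x"
proof (rule additive_eqI_UNIV [of "\<lambda>x. grho n (grho m x)"])
  fix r :: qz and c :: 'a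
  have "(\<Sum>t | qz_times m t = r. \<Sum>s | qz_times n s = t. Poly_Mapping.single s c)
      = (\<Sum>s\<in>(\<Union>t\<in>{t. qz_times m t = r}. {s. qz_times n s = t}). Poly_Mapping.single s c)"
    using assms by (intro sum.UNION_disjoint [symmetric]) (auto simp: finite_qz_roots)
  also have "(\<Union>t\<in>{t. qz_times m t = r}. {s. qz_times n s = t}) = {s. qz_times (n * m) s = r}"
    by (auto simp: qz_times_qz_times mult.commute)
  finally show "grho n (grho m (Poly_Mapping.single r c)) = grho (n * m) (Poly_Mapping.single r c)"
    by (simp add: grho_single additive.sum [OF additive_grho])
qed (intro group_algebra_intros)+

lemma gsigma_grho:
  assumes "n > 0"
  shows "gsigma n (grho n x) = of_nat n * x"
proof (rule additive_eqI_UNIV [of "\<lambda>x. gsigma n (grho n x)"])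
  fix r :: qz and c :: 'a
  have "gsigma n (grho n (Poly_Mapping.single r c))
      = (\<Sum>s | qz_times n s = r. Poly_Mapping.single (qz_times n s) c)"
    by (simp add: grho_single additive.sum [OF additive_gsigma] gsigma_single)
  also have "\<dots> = (\<Sum>s | qz_times n s = r. Poly_Mapping.single r c)"
    by (rule sum.cong) auto
  finally show "gsigma n (grho n (Poly_Mapping.single r c)) = of_nat n * Poly_Mapping.single r c"
    using assms by (simp add: card_qz_roots)
qed (intro group_algebra_intros)+

lemma grho_gsigma_coprime:
  assumes "n > 0" "coprime n m"
  shows "grho n (gsigma m x) = gsigma m (grho n x)"
proof (rule additive_eqI_UNIV [of "\<lambda>x. grho n (gsigma m x)"])
  fix r :: qz and c :: 'a
  show "grho n (gsigma m (Poly_Mapping.single r c)) = gsigma m (grho n (Poly_Mapping.single r c))"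
    using sum.reindex_bij_betw [OF qz_roots_coprime [OF assms, of r], of "\<lambda>s. Poly_Mapping.single s c"]
    by (simp add: grho_single gsigma_single additive.sum [OF additive_gsigma])
qed (intro group_algebra_intros)+

section \<open>Descent of the action from expressions to the integral BC-algebra\<close>

primrec expr_act :: "bc_expr \<Rightarrow> (qz \<Rightarrow>\<^sub>0 'k::comm_ring_1) \<Rightarrow> (qz \<Rightarrow>\<^sub>0 'k)" where
  "expr_act Zero f = 0"
| "expr_act One f = f"
| "expr_act (Add x y) f = expr_act x f + expr_act y f"
| "expr_act (Neg x) f = - expr_act x f"
| "expr_act (Mult x y) f = expr_act x (expr_act y f)"
| "expr_act (Grp g) f = gint g * f"
| "expr_act (MuT n) f = grho (nat_of_num n) f"
| "expr_act (MuS n) f = gsigma (nat_of_num n) f"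

lemma additive_expr_act: "additive (expr_act x)"
  by (induction x)
    (simp_all add: additive_def additive.add [OF additive_grho] additive.add [OF additive_gsigma]
      distrib_left algebra_simps)

lemma nat_of_num_mult: "nat_of_num (n * m) = nat_of_num n * nat_of_num m"
  by (simp only: nat_of_num_numeral numeral_mult)

text \<open>Ring axioms hold because every expression acts additively, and the defining relations
  are the identities for \<open>gsigma\<close> and \<open>grho\<close> above. \<open>f\<close> is
  generalised because in a product the left factor acts on the result of the right one.\<close>

lemma expr_act_cong: "bc_eq x y \<Longrightarrow> expr_act x f = expr_act y f"
proof (induction arbitrary: f rule: bc_eq.induct)
  case (bc_cong_mult x x' y y')
  then show ?case by simp
qed (simp_all add: additive.add [OF additive_expr_act] additive.add [OF additive_gint] algebra_simps
    gint_mult gint_one gint_rho gint_sigma gint_of_nat nat_of_num_pos nat_of_num_mult grho_mult_gsigma gsigma_mult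
    grho_gsigma_mult gsigma_gsigma grho_grho gsigma_grho grho_gsigma_coprime)

lift_definition bc_act :: "bc \<Rightarrow> (qz \<Rightarrow>\<^sub>0 'k::comm_ring_1) \<Rightarrow> (qz \<Rightarrow>\<^sub>0 'k)" is expr_act
  by (rule ext) (rule expr_act_cong)

lemma bc_act_one: "bc_act 1 f = f"
  by transfer simp

lemma bc_act_add: "bc_act (x + y) f = bc_act x f + bc_act y f"
  by transfer simp

lemma bc_act_mult: "bc_act (x * y) f = bc_act x (bc_act y f)"
  by transfer simp

lemma bc_act_grp: "bc_act (bc_grp g) f = gint g * f"
  by transfer simp

lemma bc_act_mu_tilde: "bc_act (mu_tilde n) f = grho (nat_of_num n) f"
  by transfer simp

lemma bc_act_mu_star: "bc_act (mu_star n) f = gsigma (nat_of_num n) f"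
  by transfer simp

lemma additive_bc_act: "additive (bc_act x)"
  by transfer (rule additive_expr_act)

text \<open>An element fixed by all \<open>gsigma n\<close> can be pulled out of
  \<open>grho n\<close> by the projection formula and out of \<open>gsigma n\<close> by
  multiplicativity. Constants are such elements, which makes the action linear over the
  coefficients.\<close>

lemma bc_act_mult_left:
  assumes "\<And>n. gsigma n g = g"
  shows "bc_act x (g * f) = g * bc_act x f"
  using assms
proof (transfer fixing: g f)
  fix x
  assume g: "\<And>n. gsigma n g = g"
  have "grho n (g * f) = g * grho n f" if "n > 0" for n f
    using grho_gsigma_mult [OF that, of g f] by (simp add: g)
  then show "expr_act x (g * f) = g * expr_act x f"
    by (induction x arbitrary: f)
      (simp_all add: gsigma_mult g nat_of_num_pos distrib_left mult.left_commute)
qed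

lemma bc_act_scale: "bc_act x (Poly_Mapping.single 0 c * f) = Poly_Mapping.single 0 c * bc_act x f"
  by (rule bc_act_mult_left) (simp add: gsigma_single additive.zero [OF additive_qz_times])


section \<open>The action of the tensor product\<close>

text \<open>The scalar \<open>b\<close> acts as the constant \<open>Poly_Mapping.single 0 b\<close>
  of the group ring, so no separate scalar multiplication is needed.\<close>

definition pair_act :: "(bc \<times> 'k::comm_ring_1 \<Rightarrow>\<^sub>0 int) \<Rightarrow> (qz \<Rightarrow>\<^sub>0 'k) \<Rightarrow> (qz \<Rightarrow>\<^sub>0 'k)"
  where "pair_act z f = lext (\<lambda>(a, b) n. of_int n * (Poly_Mapping.single 0 b * bc_act a f)) z"

lemma additive_pair_act_left: "additive (\<lambda>z. pair_act z f)"
  unfolding pair_act_def by (intro additive_lext) (auto intro!: additive_intros)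

lemma pair_act_of [simp]: "pair_act (frag_of (a, b)) f = Poly_Mapping.single 0 b * bc_act a f"
proof -
  have "additive (case (a, b) of (a, b) \<Rightarrow> \<lambda>n. of_int n * (Poly_Mapping.single 0 b * bc_act a f))"
    by (auto intro!: additive_intros)
  from lext_single [where G = "\<lambda>(a, b) n. of_int n * (Poly_Mapping.single 0 b * bc_act a f)", OF this]
  show ?thesis by (simp add: pair_act_def)
qed

lemma pair_act_null: "z \<in> tensor_null \<Longrightarrow> pair_act z f = 0"
  by (induction z rule: tensor_null.induct)
    (simp_all add: additive.zero [OF additive_pair_act_left] additive.diff [OF additive_pair_act_left]
      bc_act_add single_add distrib_left distrib_right)

lemma additive_pair_act: "additive (pair_act z)"
  by (induction z rule: frag_induct)
    (simp_all add: additive_def additive.zero [OF additive_pair_act_left]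
      additive.diff [OF additive_pair_act_left] additive.add [OF additive_bc_act] algebra_simps)

text \<open>On pure tensors, the scalar of the second factor must pass the operator of the first,
  which is \<open>bc_act_scale\<close>.\<close>

lemma pair_act_mult: "pair_act (pair_mult x y) f = pair_act x (pair_act y f)"
proof (induction x rule: frag_induct)
  case (one a b)
  show ?case
    by (induction y rule: frag_induct)
      (simp_all add: pair_mult_diff_right additive.zero [OF additive_pair_act_left]
        additive.diff [OF additive_pair_act_left] additive.zero [OF additive_bc_act]
        additive.diff [OF additive_bc_act] bc_act_mult bc_act_scale right_diff_distrib mult.assoc
        mult_single flip: mult.assoc)
qed (simp_all add: pair_mult_diff_left additive.zero [OF additive_pair_act_left]
    additive.diff [OF additive_pair_act_left])

lift_definition tensor_act :: "(bc, 'k::comm_ring_1) tensor \<Rightarrow> (qz \<Rightarrow>\<^sub>0 'k) \<Rightarrow> (qz \<Rightarrow>\<^sub>0 'k)"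
  is pair_act
proof
  fix x y :: "bc \<times> 'k \<Rightarrow>\<^sub>0 int" and f
  assume "tensor_eq x y"
  then have "pair_act (x - y) f = 0" by (simp add: tensor_eq_def pair_act_null)
  then show "pair_act x f = pair_act y f" by (simp add: additive.diff [OF additive_pair_act_left])
qed

lemma tensor_act_of: "tensor_act (a \<otimes> b) f = Poly_Mapping.single 0 b * bc_act a f"
  by transfer simp

lemma tensor_act_one: "tensor_act 1 f = f"
  by transfer (simp add: bc_act_one)

lemma tensor_act_add: "tensor_act (x + y) f = tensor_act x f + tensor_act y f"
  by transfer (rule additive.add [OF additive_pair_act_left])

lemma tensor_act_mult: "tensor_act (x * y) f = tensor_act x (tensor_act y f)"
  by transfer (rule pair_act_mult)

lemma additive_tensor_act: "additive (tensor_act x)"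
  by transfer (rule additive_pair_act)

lemma additive_tensor_act_left: "additive (\<lambda>x. tensor_act x f)"
  by (simp add: additive_def tensor_act_add)

lemma tensor_act_tscale: "tensor_act (tscale c x) f = Poly_Mapping.single 0 c * tensor_act x f"
  by (simp add: tscale_def tensor_act_mult tensor_act_of bc_act_one)

section \<open>The basis $\delta_a$ of $A_{p^\infty}$\<close>

text \<open>Exponents may pass 1 here, so that sums and multiples stay in the set and truncation is
  handled once, in \<open>d_ge_one\<close>.\<close>

definition S_nn :: "nat \<Rightarrow> real set"
  where "S_nn p = {of_nat k / of_nat p ^ l | k l. True}"

text \<open>The intertwiner along which the action is transported. Only its restriction to
  \<open>V_space p\<close> is meaningful: at exponents outside \<open>S_nn p\<close> the description
  in \<open>delta\<close> has no unique solution.\<close>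

definition Phi :: "nat \<Rightarrow> (real \<Rightarrow>\<^sub>0 'k::field) \<Rightarrow> (qz \<Rightarrow>\<^sub>0 'k)"
  where "Phi p = lext (\<lambda>a c. Poly_Mapping.single 0 c * delta p a)"

lemma additive_Phi: "additive (Phi p)"
  unfolding Phi_def by (intro additive_lext additive_intros)

lemma Phi_single: "Phi p (Poly_Mapping.single a c) = Poly_Mapping.single 0 c * delta p a"
  unfolding Phi_def by (intro lext_single additive_intros)

lemma lookup_scale: "Poly_Mapping.lookup (Poly_Mapping.single 0 c * x) r = c * Poly_Mapping.lookup x r"
  for c :: "'c::comm_ring_1" and r :: "'r::comm_monoid_add"
  by (simp flip: mult_map_scale_conv_mult add: Poly_Mapping.map.rep_eq when_def)

lemma one_minus_e_power:
  "(1 - e_QZ r) ^ k = (\<Sum>j\<le>k. Poly_Mapping.single (qz_of (of_nat j * r))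
    (of_nat (k choose j) * (- 1) ^ j) :: qz \<Rightarrow>\<^sub>0 'k::comm_ring_1)"
proof -
  have "(- e_QZ r) ^ j = Poly_Mapping.single (qz_of (of_nat j * r)) ((- 1 :: 'k) ^ j)" for j
    by (induction j)
      (simp_all add: qz_of_zero e_QZ_def mult_single single_uminus distrib_right qz_of_add)
  then have "of_nat n * (- e_QZ r) ^ j * 1 ^ i
      = Poly_Mapping.single (qz_of (of_nat j * r)) (of_nat n * (- 1 :: 'k) ^ j)" for n i j
    by (simp add: mult_single flip: single_of_nat)
  then show ?thesis
    using binomial_ring [of "- e_QZ r" "1 :: qz \<Rightarrow>\<^sub>0 'k" k] by simp
qed

lemma keys_add_subset:
  "Poly_Mapping.keys x \<subseteq> A \<Longrightarrow> Poly_Mapping.keys y \<subseteq> A \<Longrightarrow> Poly_Mapping.keys (x + y) \<subseteq> A"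
  using keys_add [of x y] by blast

lemma keys_scale_subset:
  fixes c :: "'c::comm_ring_1" and x :: "'r::comm_monoid_add \<Rightarrow>\<^sub>0 'c"
  shows "Poly_Mapping.keys x \<subseteq> A \<Longrightarrow> Poly_Mapping.keys (Poly_Mapping.single 0 c * x) \<subseteq> A"
  by (auto simp: in_keys_iff lookup_scale) (metis mult_zero_right subsetD in_keys_iff)

text \<open>The parameter \<open>ty\<close> ties the context to the coefficient type
  \<open>'k\<close> whose characteristic is \<open>p\<close>.\<close>

locale char_p =
  fixes p :: nat and ty :: "'k::field itself"
  assumes prime: "prime p" and char: "CHAR('k) = p"
begin

lemma p_pos: "p > 0"
  using prime by (rule prime_gt_0_nat)

lemma S_nn_common_denominator:
  assumes "a \<in> S_nn p" "b \<in> S_nn p"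
  obtains k m l where "a = of_nat k / of_nat p ^ l" "b = of_nat m / of_nat p ^ l"
proof -
  obtain k l m n where "a = of_nat k / of_nat p ^ l" "b = of_nat m / of_nat p ^ n"
    using assms by (auto simp: S_nn_def)
  then have "a = of_nat (k * p ^ n) / of_nat p ^ (l + n)" "b = of_nat (m * p ^ l) / of_nat p ^ (l + n)"
    using p_pos by (simp_all add: power_add)
  then show ?thesis by (rule that)
qed

lemma S_nn_add:
  assumes "a \<in> S_nn p" "b \<in> S_nn p"
  shows "a + b \<in> S_nn p"
proof -
  obtain k m l where "a = of_nat k / of_nat p ^ l" "b = of_nat m / of_nat p ^ l"
    using assms by (rule S_nn_common_denominator)
  then have "a + b = of_nat (k + m) / of_nat p ^ l"
    by (simp add: add_divide_distrib)
  then show ?thesis unfolding S_nn_def by blast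
qed

lemma S_nn_mult:
  assumes "a \<in> S_nn p" "b \<in> S_nn p"
  shows "a * b \<in> S_nn p"
proof -
  obtain k l m n where "a = of_nat k / of_nat p ^ l" "b = of_nat m / of_nat p ^ n"
    using assms by (auto simp: S_nn_def)
  then have "a * b = of_nat (k * m) / of_nat p ^ (l + n)"
    by (simp add: power_add)
  then show ?thesis unfolding S_nn_def by blast
qed

lemma S_nn_of_nat: "of_nat k \<in> S_nn p"
proof -
  have "(of_nat k :: real) = of_nat k / of_nat p ^ 0" by simp
  then show ?thesis unfolding S_nn_def by blast
qed

lemma S_nn_inverse_power: "1 / of_nat p ^ l \<in> S_nn p"
  unfolding S_nn_def by (rule CollectI) (metis of_nat_1)

lemma S_nn_nonneg: "a \<in> S_nn p \<Longrightarrow> a \<ge> 0"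
  by (auto simp: S_nn_def)

lemma S_nn_one_minus:
  assumes "a \<in> S_nn p" "a \<le> 1"
  shows "1 - a \<in> S_nn p"
proof -
  obtain k l where a: "a = of_nat k / of_nat p ^ l" using assms by (auto simp: S_nn_def)
  then have "real k \<le> real (p ^ l)"
    using assms(2) p_pos by simp
  then have "k \<le> p ^ l"
    by (simp only: of_nat_le_iff)
  then have "1 - a = of_nat (p ^ l - k) / of_nat p ^ l"
    using p_pos by (simp add: a of_nat_diff field_simps)
  then show ?thesis unfolding S_nn_def by blast
qed

lemma S01_iff: "a \<in> S01 p \<longleftrightarrow> a \<in> S_nn p \<and> a < 1"
proof
  assume "a \<in> S01 p"
  then obtain k n where a: "a = of_int k / of_nat p ^ n" "a \<ge> 0" "a < 1"
    by (auto simp: S01_def S_set_def)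
  moreover have "real p ^ n > 0" using p_pos by simp
  ultimately have "k \<ge> 0" by (auto simp: zero_le_divide_iff)
  then have "a = of_nat (nat k) / of_nat p ^ n" by (simp add: a)
  then show "a \<in> S_nn p \<and> a < 1" using a(3) unfolding S_nn_def by blast
next
  assume a: "a \<in> S_nn p \<and> a < 1"
  then obtain k n where "a = of_nat k / of_nat p ^ n" by (auto simp: S_nn_def)
  then have "a = of_int (int k) / of_nat p ^ n" by simp
  then have "a \<in> S_set p" unfolding S_set_def by blast
  then show "a \<in> S01 p" using a S_nn_nonneg by (simp add: S01_def)
qed

abbreviation d :: "real \<Rightarrow> qz \<Rightarrow>\<^sub>0 'k"
  where "d \<equiv> delta p"

lemma d_eq: "d (of_nat k / of_nat p ^ l) = (1 - e_QZ (1 / of_nat p ^ l)) ^ k"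
  by (rule delta_eq [OF prime char])

lemma d_zero: "d 0 = 1"
  using d_eq [of 0 0] by simp

lemma d_mult:
  assumes "a \<in> S_nn p" "b \<in> S_nn p"
  shows "d a * d b = d (a + b)"
proof -
  obtain k m l where a: "a = of_nat k / of_nat p ^ l" and b: "b = of_nat m / of_nat p ^ l"
    using assms by (rule S_nn_common_denominator)
  have ab: "a + b = of_nat (k + m) / of_nat p ^ l"
    by (simp add: a b add_divide_distrib)
  show ?thesis unfolding ab unfolding a b d_eq by (rule power_add [symmetric])
qed

text \<open>In Q/Z the class of 1 is 0, so \<open>1 - e_QZ 1 = 0\<close>. Multiplying by
  \<open>d (a - 1)\<close> then kills every exponent \<open>a \<ge> 1\<close>, matching the
  convention for \<open>xi\<close>.\<close>

lemma d_one: "d 1 = 0"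
proof -
  have "qz_of 1 = 0" by (simp add: qz_of_eq_iff flip: qz_of_zero)
  then show ?thesis using d_eq [of 1 0] by (simp add: e_QZ_def)
qed

lemma d_ge_one:
  assumes "a \<in> S_nn p" "a \<ge> 1"
  shows "d a = 0"
proof -
  obtain k l where a: "a = of_nat k / of_nat p ^ l" using assms by (auto simp: S_nn_def)
  then have "real (p ^ l) \<le> real k"
    using assms(2) p_pos by simp
  then have "p ^ l \<le> k"
    by (simp only: of_nat_le_iff)
  then have "a - 1 = of_nat (k - p ^ l) / of_nat p ^ l"
    using p_pos by (simp add: a of_nat_diff field_simps)
  then have "a - 1 \<in> S_nn p" unfolding S_nn_def by blast
  then show ?thesis
    using d_mult [of "a - 1" 1] S_nn_of_nat [of 1] by (simp add: d_one)
qed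

text \<open>For \<open>k < p^l\<close> none of the fractions \<open>j / p^l\<close> with
  \<open>0 < j \<le> k\<close> is an integer, so only the term \<open>j = 0\<close> of the binomial
  expansion contributes. This coefficient functional tests whether an exponent is below 1.\<close>

lemma lookup_d_zero:
  assumes "a \<in> S_nn p"
  shows "Poly_Mapping.lookup (d a) 0 = (if a < 1 then 1 else 0)"
proof (cases "a < 1")
  case True
  obtain k l where a: "a = of_nat k / of_nat p ^ l" using assms by (auto simp: S_nn_def)
  then have "real k < real (p ^ l)"
    using True p_pos by simp
  then have k: "k < p ^ l"
    by (simp only: of_nat_less_iff)
  have "qz_of (of_nat j * (1 / of_nat p ^ l)) = 0 \<longleftrightarrow> j = 0" if "j \<le> k" for j
  proof
    assume "qz_of (of_nat j * (1 / of_nat p ^ l)) = 0"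
    then obtain i where "of_nat j / of_nat p ^ l = (of_int i :: rat)"
      by (auto simp: qz_of_eq_iff elim: Ints_cases simp flip: qz_of_zero)
    then have "(of_int (int j) :: rat) = of_int (i * int (p ^ l))"
      using p_pos by (simp add: field_simps)
    then have "int j = i * int (p ^ l)"
      by (simp only: of_int_eq_iff)
    then have "p ^ l dvd j"
      by (metis dvd_triv_right of_nat_dvd_iff)
    then show "j = 0"
      using that k by (metis dvd_imp_le le_less_trans linorder_not_less neq0_conv)
  qed (simp add: qz_of_zero)
  then have "(\<Sum>j\<le>k. of_nat (k choose j) * (- 1 :: 'k) ^ j when qz_of (of_nat j * (1 / of_nat p ^ l)) = 0)
      = (\<Sum>j\<le>k. of_nat (k choose j) * (- 1) ^ j when j = 0)"
    by (intro sum.cong) (auto simp: when_def)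
  also have "\<dots> = 1" by (simp add: when_def)
  finally show ?thesis
    using True unfolding a d_eq one_minus_e_power lookup_sum lookup_single by simp
qed (simp add: d_ge_one assms)

text \<open>The exponent is rewritten as \<open>k * p / p^(l + 1)\<close>: \<open>gsigma p\<close>
  turns \<open>e_QZ (1 / p^(l + 1))\<close> into \<open>e_QZ (1 / p^l)\<close>, even when
  \<open>l = 0\<close>.\<close>

lemma gsigma_d:
  assumes "a \<in> S_nn p"
  shows "gsigma p (d a) = d (of_nat p * a)"
proof -
  obtain k l where a: "a = of_nat k / of_nat p ^ l" using assms by (auto simp: S_nn_def)
  have *: "of_nat p * a = of_nat (k * p) / of_nat p ^ l" by (simp add: a)
  have "gsigma p (e_QZ (1 / of_nat p ^ Suc l)) = (e_QZ (1 / of_nat p ^ l) :: qz \<Rightarrow>\<^sub>0 'k)"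
    using p_pos by (simp add: e_QZ_def gsigma_single qz_times_of)
  moreover have "a = of_nat (k * p) / of_nat p ^ Suc l" using p_pos by (simp add: a)
  ultimately show ?thesis
    unfolding * by (simp only: d_eq gsigma_power additive.diff [OF additive_gsigma] gsigma_one)
qed

text \<open>By Pascal's rule two consecutive values add up to \<open>p choose Suc j\<close>, which
  \<open>p\<close> divides; so the sign alternates from the value 1 at \<open>j = 0\<close>.\<close>

lemma choose_pred_prime:
  assumes "j < p"
  shows "of_nat (p - 1 choose j) = (- 1 :: 'k) ^ j"
  using assms
proof (induction j)
  case (Suc j)
  have "p choose Suc j = (p - 1 choose j) + (p - 1 choose Suc j)"
    using p_pos by (cases p) auto
  moreover have "of_nat (p choose Suc j) = (0 :: 'k)"
    using dvd_choose_prime [of "Suc j" p] Suc.prems prime p_pos by (simp add: of_nat_eq_0_iff_char_dvd char)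
  ultimately have "of_nat (p - 1 choose j) + of_nat (p - 1 choose Suc j) = (0 :: 'k)"
    by (metis of_nat_add)
  then show ?case using Suc by (simp add: add_eq_0_iff)
qed simp

text \<open>The sum $\tilde\rho_p(1) = \sum_{j<p} e(j/p)$ equals $(1 - e(1/p))^{p-1}$, as $\sum_{j<p} x^j = (1 - x)^{p-1}$ in
  characteristic $p$.\<close>

lemma grho_one: "grho p 1 = d (of_nat (p - 1) / of_nat p)"
proof -
  have "grho p (1 :: qz \<Rightarrow>\<^sub>0 'k) = (\<Sum>s | qz_times p s = qz_of 0. Poly_Mapping.single s 1)"
    using grho_single [of p 0 "1 :: 'k"] by (simp add: qz_of_zero)
  also have "\<dots> = (\<Sum>j<p. Poly_Mapping.single (qz_of (of_nat j / of_nat p)) 1)"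
    using qz_roots [OF p_pos, of 0] by (simp add: sum.reindex)
  also have "\<dots> = (\<Sum>j\<le>p - 1. Poly_Mapping.single (qz_of (of_nat j * (1 / of_nat p)))
      (of_nat (p - 1 choose j) * (- 1) ^ j))"
  proof (rule sum.cong)
    fix j assume "j \<in> {..p - 1}"
    then have "j < p" using p_pos by auto
    then show "Poly_Mapping.single (qz_of (of_nat j / of_nat p)) 1
        = Poly_Mapping.single (qz_of (of_nat j * (1 / of_nat p)))
            (of_nat (p - 1 choose j) * (- 1 :: 'k) ^ j)"
      by (simp add: choose_pred_prime [unfolded One_nat_def] flip: power_mult_distrib)
  qed (use p_pos in auto)
  also have "\<dots> = (1 - e_QZ (1 / of_nat p ^ 1)) ^ (p - 1)"
    by (simp only: one_minus_e_power power_one_right)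
  also have "\<dots> = d (of_nat (p - 1) / of_nat p ^ 1)"
    by (simp only: d_eq)
  finally show ?thesis by simp
qed

text \<open>\<open>d a\<close> is \<open>gsigma p\<close> of \<open>d (a / p)\<close>, so the
  projection formula pulls \<open>d (a / p)\<close> out and leaves \<open>grho p 1\<close>.\<close>

lemma grho_d:
  assumes "a \<in> S_nn p"
  shows "grho p (d a) = d ((a + of_nat p - 1) / of_nat p)"
proof -
  have a: "a * (1 / of_nat p) \<in> S_nn p"
    using S_nn_mult [OF assms S_nn_inverse_power [of 1]] by simp
  have p1: "of_nat (p - 1) * (1 / of_nat p) \<in> S_nn p"
    using S_nn_mult [OF S_nn_of_nat S_nn_inverse_power [of 1]] by simp
  have "d a = gsigma p (d (a * (1 / of_nat p))) * 1"
    using gsigma_d [OF a] p_pos by simp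
  then have "grho p (d a) = d (a * (1 / of_nat p)) * d (of_nat (p - 1) * (1 / of_nat p))"
    using grho_gsigma_mult [OF p_pos, of "d (a * (1 / of_nat p))" 1] by (simp add: grho_one)
  also have "\<dots> = d (a * (1 / of_nat p) + of_nat (p - 1) * (1 / of_nat p))"
    by (rule d_mult [OF a p1])
  also have "a * (1 / of_nat p) + of_nat (p - 1) * (1 / of_nat p) = (a + of_nat p - 1) / of_nat p"
    using p_pos by (simp add: of_nat_diff field_simps)
  finally show ?thesis .
qed

text \<open>The coefficient at $0$ of $\delta_b \cdot \sum_a f(a)\,\delta_a$ is the sum of \<open>f a\<close> over
  $a < 1 - b$; take for $1 - b$ the second smallest element of the support.\<close>

lemma Phi_eq_0:
  fixes f :: "real \<Rightarrow>\<^sub>0 'k"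
  assumes "f \<in> V_space p" "Phi p f = 0"
  shows "f = 0"
proof (rule ccontr)
  assume "f \<noteq> 0"
  define K where "K = Poly_Mapping.keys f"
  have K: "finite K" "K \<noteq> {}" and KS: "\<And>a. a \<in> K \<Longrightarrow> a \<in> S_nn p \<and> a < 1"
    using \<open>f \<noteq> 0\<close> assms(1) by (auto simp: K_def V_space_def S01_iff)
  \<comment> \<open>The element 1 stands in for a singleton support; then \<open>1 - t = 0\<close>
    and the multiplier \<open>d (1 - t)\<close> is 1.\<close>
  define t where "t = Min (insert 1 (K - {Min K}))"
  have t: "t \<in> insert 1 (K - {Min K})"
    unfolding t_def using K by (intro Min_in) auto
  then have t1: "t \<in> S_nn p" "t \<le> 1"
    using KS S_nn_of_nat [of 1] by force+
  have lt: "a < t \<longleftrightarrow> a = Min K" if "a \<in> K" for a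
  proof
    assume "a < t"
    then show "a = Min K" using that K by (auto simp: t_def)
  next
    assume "a = Min K"
    then show "a < t"
      using t KS [OF that] Min_le [OF K(1), of t] by auto
  qed
  have eq: "d (1 - t) * Phi p f = (\<Sum>a\<in>K. Poly_Mapping.single 0 (Poly_Mapping.lookup f a) * d (a + (1 - t)))"
    unfolding Phi_def lext_def sum_distrib_left K_def [symmetric]
  proof (rule sum.cong)
    fix a assume "a \<in> K"
    then have "d a * d (1 - t) = d (a + (1 - t))"
      using d_mult [of a "1 - t"] KS S_nn_one_minus [OF t1] by simp
    then show "d (1 - t) * (Poly_Mapping.single 0 (Poly_Mapping.lookup f a) * d a)
        = Poly_Mapping.single 0 (Poly_Mapping.lookup f a) * d (a + (1 - t))"
      by (metis mult.commute mult.left_commute)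
  qed simp
  have "0 = Poly_Mapping.lookup (d (1 - t) * Phi p f) 0"
    by (simp add: assms(2))
  also have "\<dots> = (\<Sum>a\<in>K. Poly_Mapping.lookup f a * Poly_Mapping.lookup (d (a + (1 - t))) 0)"
    unfolding eq by (simp add: lookup_scale lookup_sum)
  also have "\<dots> = (\<Sum>a\<in>K. if a = Min K then Poly_Mapping.lookup f a else 0)"
  proof (rule sum.cong)
    fix a assume a: "a \<in> K"
    have "a + (1 - t) \<in> S_nn p"
      using KS [OF a] S_nn_one_minus [OF t1] S_nn_add by blast
    then show "Poly_Mapping.lookup f a * Poly_Mapping.lookup (d (a + (1 - t))) 0
        = (if a = Min K then Poly_Mapping.lookup f a else 0)"
      using lt [OF a] by (simp add: lookup_d_zero)
  qed simp
  also have "\<dots> = Poly_Mapping.lookup f (Min K)"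
    using K by simp
  finally show False
    using Min_in [OF K] by (simp add: K_def in_keys_iff)
qed

section \<open>The span of the deltas is the group algebra of the \<open>p\<close>-power
  fractions\<close>

lemma inj_on_Phi: "inj_on (Phi p) (V_space p :: (real \<Rightarrow>\<^sub>0 'k) set)"
proof
  fix f g :: "real \<Rightarrow>\<^sub>0 'k"
  assume f: "f \<in> V_space p" and g: "g \<in> V_space p" and "Phi p f = Phi p g"
  then have "Phi p (f - g) = 0" by (simp add: additive.diff [OF additive_Phi])
  moreover have "f - g \<in> V_space p"
    using f g keys_diff [of f g] by (auto simp: V_space_def)
  ultimately show "f = g" using Phi_eq_0 [of "f - g"] by simp
qed

lemma scale_d_in_Phi:
  fixes c :: 'k
  assumes "a \<in> S_nn p"
  shows "Poly_Mapping.single 0 c * d a \<in> Phi p ` V_space p"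
proof (cases "a < 1")
  case True
  then have "Poly_Mapping.single a c \<in> V_space p"
    using assms by (simp add: V_space_def S01_iff)
  then show ?thesis by (metis Phi_single image_eqI)
next
  case False
  then have "Poly_Mapping.single 0 c * d a = Phi p 0"
    using d_ge_one [OF assms] by (simp add: additive.zero [OF additive_Phi])
  moreover have "0 \<in> V_space p" by (simp add: V_space_def)
  ultimately show ?thesis by blast
qed

lemma Phi_add_closed:
  assumes "x \<in> Phi p ` V_space p" "y \<in> Phi p ` (V_space p :: (real \<Rightarrow>\<^sub>0 'k) set)"
  shows "x + y \<in> Phi p ` V_space p"
proof -
  obtain f g where "f \<in> V_space p" "g \<in> V_space p" and "x = Phi p f" "y = Phi p g"
    using assms by blast
  moreover from this have "f + g \<in> V_space p" by (simp add: V_space_def keys_add_subset)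
  ultimately show ?thesis by (metis additive.add [OF additive_Phi] image_eqI)
qed

lemma Phi_induct [consumes 1, case_names d add]:
  assumes "x \<in> Phi p ` V_space p"
    and d: "\<And>a c. a \<in> S_nn p \<Longrightarrow> a < 1 \<Longrightarrow> P (Poly_Mapping.single 0 (c :: 'k) * d a)"
    and add: "\<And>x y. P x \<Longrightarrow> P y \<Longrightarrow> P (x + y)"
  shows "P x"
proof -
  obtain f :: "real \<Rightarrow>\<^sub>0 'k" where f: "f \<in> V_space p" "x = Phi p f" using assms(1) by blast
  have "Poly_Mapping.keys f \<subseteq> S01 p" using f(1) by (simp add: V_space_def)
  then have "P (Phi p f)"
  proof (induction f rule: poly_mapping_induct)
    case zero
    have "0 \<in> S_nn p" using S_nn_of_nat [of 0] by simp
    then show ?case using d [of 0 0] by (simp add: additive.zero [OF additive_Phi])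
  qed (simp_all add: Phi_single additive.add [OF additive_Phi] S01_iff d add)
  then show ?thesis by (simp add: f)
qed

lemma Phi_mult_closed:
  assumes "x \<in> Phi p ` V_space p" "y \<in> Phi p ` (V_space p :: (real \<Rightarrow>\<^sub>0 'k) set)"
  shows "x * y \<in> Phi p ` V_space p"
  using assms(1)
proof (induction x rule: Phi_induct)
  case (d a c)
  note a = this
  show ?case
    using assms(2)
  proof (induction y rule: Phi_induct)
    case (d b c')
    have "Poly_Mapping.single 0 c * d a * (Poly_Mapping.single 0 c' * d b)
        = (Poly_Mapping.single 0 c * Poly_Mapping.single 0 c') * (d a * d b)"
      by (simp only: ac_simps)
    also have "\<dots> = Poly_Mapping.single 0 (c * c') * d (a + b)"
      using a d by (simp add: mult_single d_mult)
    finally show ?case using a d by (simp add: scale_d_in_Phi S_nn_add)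
  qed (simp add: distrib_left Phi_add_closed)
qed (simp add: distrib_right Phi_add_closed)

text \<open>\<open>e_QZ (1 / p^l)\<close> is \<open>d 0 - d (1 / p^l)\<close>, and the image of
  \<open>Phi p\<close> is closed under products.\<close>

lemma e_in_Phi: "e_QZ (of_nat k * (1 / of_nat p ^ l)) \<in> Phi p ` (V_space p :: (real \<Rightarrow>\<^sub>0 'k) set)"
proof -
  have one: "1 \<in> Phi p ` (V_space p :: (real \<Rightarrow>\<^sub>0 'k) set)"
    using scale_d_in_Phi [of 0 1] S_nn_of_nat [of 0] by (simp add: d_zero)
  have "1 + Poly_Mapping.single 0 (- 1) * d (1 / of_nat p ^ l) = e_QZ (1 / of_nat p ^ l)"
    using d_eq [of 1 l] by (simp add: single_uminus)
  then have e: "e_QZ (1 / of_nat p ^ l) \<in> Phi p ` (V_space p :: (real \<Rightarrow>\<^sub>0 'k) set)"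
    by (metis Phi_add_closed one scale_d_in_Phi S_nn_inverse_power)
  have "e_QZ (1 / of_nat p ^ l) ^ k \<in> Phi p ` (V_space p :: (real \<Rightarrow>\<^sub>0 'k) set)"
    by (induction k) (simp_all add: one e Phi_mult_closed)
  then show ?thesis by (simp only: e_power)
qed

lemma Phi_image: "Phi p ` (V_space p :: (real \<Rightarrow>\<^sub>0 'k) set) = A_pinf p"
proof (intro equalityI subsetI)
  fix x :: "qz \<Rightarrow>\<^sub>0 'k" assume "x \<in> Phi p ` V_space p"
  then show "x \<in> A_pinf p"
  proof (induction x rule: Phi_induct)
    case (d a c)
    then obtain k l where a: "a = of_nat k / of_nat p ^ l" by (auto simp: S_nn_def)
    have "qz_of (of_nat j * (1 / of_nat p ^ l)) \<in> qz_p p" for j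
    proof -
      have "(of_nat j * (1 / of_nat p ^ l) :: rat) = of_int (int j) / of_nat p ^ l" by simp
      then show ?thesis unfolding qz_p_def by (metis (mono_tags, lifting) mem_Collect_eq)
    qed
    then have "Poly_Mapping.keys (d a) \<subseteq> qz_p p"
      unfolding a d_eq one_minus_e_power
      by (intro order_trans [OF keys_sum]) auto
    then show ?case by (simp add: A_pinf_def keys_scale_subset)
  qed (simp add: A_pinf_def keys_add_subset)
next
  fix x :: "qz \<Rightarrow>\<^sub>0 'k" assume "x \<in> A_pinf p"
  then have "Poly_Mapping.keys x \<subseteq> qz_p p" by (simp add: A_pinf_def)
  then show "x \<in> Phi p ` V_space p"
  proof (induction x rule: poly_mapping_induct)
    case zero
    show ?case using scale_d_in_Phi [of 0 0] S_nn_of_nat [of 0] by simp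
  next
    case (single r c)
    then obtain k l where r: "r = qz_of (of_int k / of_nat p ^ l)" by (auto simp: qz_p_def)
    \<comment> \<open>\<open>e_in_Phi\<close> takes natural numerators; reducing \<open>k\<close>
      modulo \<open>p^l\<close> changes the fraction by an integer only.\<close>
    define j where "j = nat (k mod int (p ^ l))"
    have "int j = k - int (p ^ l) * (k div int (p ^ l))"
      using p_pos by (simp add: j_def minus_mult_div_eq_mod)
    then have "(of_nat j :: rat) = of_int k - of_nat (p ^ l) * of_int (k div int (p ^ l))"
      by (metis of_int_diff of_int_mult of_int_of_nat_eq)
    then have "of_int k / of_nat p ^ l - of_nat j * (1 / of_nat p ^ l) = (of_int (k div int (p ^ l)) :: rat)"
      using p_pos by (simp add: field_simps)
    then have "r = qz_of (of_nat j * (1 / of_nat p ^ l))"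
      by (simp add: r qz_of_eq_iff)
    then have "Poly_Mapping.single r c = (Poly_Mapping.single 0 c * d 0) * e_QZ (of_nat j * (1 / of_nat p ^ l))"
      by (simp add: e_QZ_def mult_single d_zero)
    then show ?case
      using Phi_mult_closed [OF scale_d_in_Phi e_in_Phi] S_nn_of_nat [of 0] by simp
  qed (simp add: Phi_add_closed)
qed

lemmas A_pinf_induct [consumes 1, case_names d add] = Phi_induct [unfolded Phi_image]

lemmas scale_d_in_A_pinf = scale_d_in_Phi [unfolded Phi_image]

lemmas A_pinf_mult = Phi_mult_closed [unfolded Phi_image]

lemmas A_pinf_add = Phi_add_closed [unfolded Phi_image]

lemma scale_in_A_pinf: "x \<in> A_pinf p \<Longrightarrow> Poly_Mapping.single 0 (c :: 'k) * x \<in> A_pinf p"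
  by (simp add: A_pinf_def keys_scale_subset)

end

section \<open>Relations in the $p$-part\<close>

lemma additive_bc_grp: "additive bc_grp"
proof
  fix f g
  show "bc_grp (f + g) = bc_grp f + bc_grp g" by transfer (rule bc_grp_add)
qed

lemma bc_grp_mult: "bc_grp (f * g) = bc_grp f * bc_grp g"
  by transfer (rule bc_grp_mult)

lemma bc_grp_one: "bc_grp 1 = 1"
  by transfer (rule bc_grp_one)

lemma mu_tilde_grp_mu_star: "mu_tilde n * bc_grp f * mu_star n = bc_grp (rho (nat_of_num n) f)"
  by transfer (rule bc_rho)

lemma mu_star_grp: "mu_star n * bc_grp f = bc_grp (sigma (nat_of_num n) f) * mu_star n"
  by transfer (rule bc_sigma_star)

lemma grp_mu_tilde: "bc_grp f * mu_tilde n = mu_tilde n * bc_grp (sigma (nat_of_num n) f)"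
  by transfer (rule bc_sigma_tilde)

lemma mu_star_mu_tilde: "mu_star n * mu_tilde n = bc_grp (of_nat (nat_of_num n))"
  by transfer (rule bc_star_tilde)

lemma additive_tensor_of_left: "additive (\<lambda>a. a \<otimes> b)"
proof
  fix a a'
  show "(a + a') \<otimes> b = a \<otimes> b + a' \<otimes> b"
    by transfer (use tn_left in \<open>simp add: tensor_eq_def diff_diff_add\<close>)
qed

lemma additive_tensor_of_right: "additive (\<lambda>b. a \<otimes> b)"
proof
  fix b b'
  show "a \<otimes> (b + b') = a \<otimes> b + a \<otimes> b'"
    by transfer (use tn_right in \<open>simp add: tensor_eq_def diff_diff_add\<close>)
qed

lemma tensor_of_mult: "(a \<otimes> b) * (a' \<otimes> b') = (a * a') \<otimes> (b * b')"
  by transfer (simp add: tensor_eq_refl)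

lemma tensor_one: "1 = 1 \<otimes> 1"
  by transfer (simp add: tensor_eq_refl)

text \<open>Derived from biadditivity alone. It carries the number \<open>p\<close> in
  \<open>mu_star_mu_tilde\<close> over to the field, where it is 0.\<close>

lemma tensor_of_nat_left: "(bc_grp (of_nat n) \<otimes> b) = (1 \<otimes> (of_nat n * b))"
proof (induction n)
  case 0
  then show ?case
    by (simp add: additive.zero [OF additive_bc_grp] additive.zero [OF additive_tensor_of_left]
      additive.zero [OF additive_tensor_of_right])
next
  case (Suc n)
  then show ?case
    by (simp add: additive.add [OF additive_bc_grp] additive.add [OF additive_tensor_of_left]
      additive.add [OF additive_tensor_of_right] bc_grp_one distrib_right)
qed

text \<open>Elements are classes of integer combinations of pairs; closure under differences covers
  integer coefficients and also yields 0.\<close>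

lemma tensor_induct [case_names of diff]:
  assumes "\<And>a b. P (a \<otimes> b)" "\<And>x y. P x \<Longrightarrow> P y \<Longrightarrow> P (x - y)"
  shows "P x"
proof -
  have "P 0" using assms(2) [OF assms(1) assms(1), of 0 0 0 0] by simp
  have "P (abs_tensor z)" for z
  proof (induction z rule: frag_induct)
    case zero
    show ?case using \<open>P 0\<close> by (simp only: zero_tensor.abs_eq)
  next
    case (one a b)
    show ?case using assms(1) [of a b] by (simp only: tensor_of.abs_eq)
  next
    case (diff x y)
    have "abs_tensor x - abs_tensor y = abs_tensor (x - y)"
      by (simp only: minus_tensor_def plus_tensor.abs_eq uminus_tensor.abs_eq add_uminus_conv_diff)
    then show ?case using assms(2) [OF diff] by simp
  qed
  then show ?thesis
    using Quotient3_abs_rep [OF Quotient3_tensor] by metis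
qed

lemma one_tensor_central: "(1 \<otimes> c) * x = x * (1 \<otimes> c)" for c :: "'k::field"
  by (induction x rule: tensor_induct)
    (simp_all add: tensor_of_mult mult.commute left_diff_distrib right_diff_distrib)

lemma mult_tscale: "x * tscale c y = tscale c (x * y)"
  by (simp only: tscale_def one_tensor_central [of c x] mult.assoc [symmetric])

lemma tscale_mult: "tscale c x * y = tscale c (x * y)"
  by (simp add: tscale_def mult.assoc)

lemma tscale_one: "tscale 1 x = x"
  by (simp add: tscale_def flip: tensor_one)

lemma additive_tscale: "additive (tscale c)"
  by (simp add: additive_def tscale_def distrib_left)

lemma additive_tscale_left: "additive (\<lambda>c. tscale c x)"
  by (simp add: additive_def tscale_def distrib_right additive.add [OF additive_tensor_of_right])

lemma additive_grp_alg: "additive (grp_alg :: (qz \<Rightarrow>\<^sub>0 'k::field) \<Rightarrow> _)"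
proof -
  have eq: "(grp_alg :: (qz \<Rightarrow>\<^sub>0 'k) \<Rightarrow> _) = lext (\<lambda>r c. bc_grp (frag_of r) \<otimes> c)"
    by (simp add: fun_eq_iff grp_alg_def lext_def)
  show ?thesis unfolding eq by (intro additive_lext additive_tensor_of_right)
qed

lemma grp_alg_single: "grp_alg (Poly_Mapping.single r c) = bc_grp (frag_of r) \<otimes> c"
  by (simp add: grp_alg_def additive.zero [OF additive_tensor_of_right])

lemmas grp_alg_intros = additive_intros additive_comp [OF additive_grp_alg]
  additive_gsigma additive_grho additive_comp [OF additive_gsigma] additive_comp [OF additive_grho]
  additive_grp_alg additive_comp [OF additive_tscale]

lemma grp_alg_mult: "grp_alg (x * y) = grp_alg x * grp_alg y"
proof (rule additive_eqI_UNIV [of "\<lambda>x. grp_alg (x * y)"])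
  fix r :: qz and c :: 'a
  show "grp_alg (Poly_Mapping.single r c * y) = grp_alg (Poly_Mapping.single r c) * grp_alg y"
    by (rule additive_eqI_UNIV; (intro grp_alg_intros)?)
      (simp add: grp_alg_single mult_single tensor_of_mult flip: bc_grp_mult)
qed (intro grp_alg_intros)+

lemma grp_alg_scalar: "grp_alg (Poly_Mapping.single 0 c) = 1 \<otimes> c"
  by (simp add: grp_alg_single bc_grp_one)

lemma grp_alg_one: "grp_alg 1 = 1"
  using grp_alg_scalar [of 1] by (simp flip: tensor_one)

lemma grp_alg_scale: "grp_alg (Poly_Mapping.single 0 c * x) = tscale c (grp_alg x)"
  by (simp add: grp_alg_mult grp_alg_scalar tscale_def)

lemma tensor_act_grp_alg: "tensor_act (grp_alg x) f = x * f"
proof (rule additive_eqI_UNIV [of "\<lambda>x. tensor_act (grp_alg x) f"])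
  show "additive (\<lambda>x. tensor_act (grp_alg x) f)"
    by (simp add: additive_def additive.add [OF additive_grp_alg] tensor_act_add)
  show "tensor_act (grp_alg (Poly_Mapping.single r c)) f = Poly_Mapping.single r c * f" for r c
    by (simp add: grp_alg_single tensor_act_of bc_act_grp gint_single mult_single flip: mult.assoc)
qed (intro grp_alg_intros)

section \<open>Commutation rules for the generators of the \<open>p\<close>-part\<close>

context char_p
begin

abbreviation u :: "(bc, 'k) tensor"
  where "u \<equiv> mu_tilde_p p"

abbreviation v :: "(bc, 'k) tensor"
  where "v \<equiv> mu_star_p p"

lemma nat_of_num_p: "nat_of_num (num_of_nat p) = p"
  using p_pos by (simp add: num_of_nat_inverse)

lemma tensor_act_u: "tensor_act u f = grho p f"
  by (simp add: mu_tilde_p_def tensor_act_of bc_act_mu_tilde nat_of_num_p)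

lemma tensor_act_v: "tensor_act v f = gsigma p f"
  by (simp add: mu_star_p_def tensor_act_of bc_act_mu_star nat_of_num_p)

lemma v_grp: "v * grp_alg x = grp_alg (gsigma p x) * v"
  by (rule additive_eqI_UNIV; (intro grp_alg_intros)?)
    (simp add: mu_star_p_def grp_alg_single gsigma_single tensor_of_mult mu_star_grp nat_of_num_p sigma_def)

lemma grp_u: "grp_alg x * u = u * grp_alg (gsigma p x)"
  by (rule additive_eqI_UNIV; (intro grp_alg_intros)?)
    (simp add: mu_tilde_p_def grp_alg_single gsigma_single tensor_of_mult grp_mu_tilde nat_of_num_p sigma_def)

lemma u_grp_v: "u * grp_alg x * v = grp_alg (grho p x)"
  by (rule additive_eqI_UNIV; (intro grp_alg_intros)?)
    (simp add: mu_tilde_p_def mu_star_p_def grp_alg_single grho_single tensor_of_mult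
      mu_tilde_grp_mu_star nat_of_num_p rho_def additive.sum [OF additive_grp_alg]
      additive.sum [OF additive_bc_grp] additive.sum [OF additive_tensor_of_left])

lemma v_u: "v * u = 0"
  using of_nat_CHAR [where 'a = 'k]
  by (simp add: mu_tilde_p_def mu_star_p_def tensor_of_mult mu_star_mu_tilde nat_of_num_p
      tensor_of_nat_left char additive.zero [OF additive_tensor_of_right])

lemma v_power_grp: "v ^ n * grp_alg x = grp_alg ((gsigma p ^^ n) x) * v ^ n"
proof (induction n)
  case (Suc n)
  have "v ^ Suc n * grp_alg x = v * (v ^ n * grp_alg x)" by (simp add: mult.assoc)
  also have "\<dots> = (v * grp_alg ((gsigma p ^^ n) x)) * v ^ n" by (simp add: Suc mult.assoc)
  finally show ?case by (simp add: v_grp mult.assoc)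
qed simp

lemma grp_u_power: "grp_alg x * u ^ n = u ^ n * grp_alg ((gsigma p ^^ n) x)"
proof (induction n)
  case (Suc n)
  have "grp_alg x * u ^ Suc n = (grp_alg x * u ^ n) * u" by (simp only: power_Suc2 mult.assoc)
  also have "\<dots> = u ^ n * (grp_alg ((gsigma p ^^ n) x) * u)" by (simp add: Suc mult.assoc)
  finally show ?case by (simp only: grp_u power_Suc2 mult.assoc funpow.simps o_apply)
qed simp

lemma u_power_grp_v_power: "u ^ n * grp_alg x * v ^ n = grp_alg ((grho p ^^ n) x)"
proof (induction n)
  case (Suc n)
  have "u ^ Suc n * grp_alg x * v ^ Suc n = u * (u ^ n * grp_alg x * v ^ n) * v"
    by (simp only: power_Suc2 [of v] power_Suc [of u] mult.assoc)
  then show ?case by (simp add: Suc u_grp_v)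
qed simp

lemma v_power_u_power:
  assumes "n > 0" "m > 0"
  shows "v ^ n * u ^ m = 0"
  using assms
proof (cases n; cases m)
  fix i j
  assume "n = Suc i" "m = Suc j"
  then have "v ^ n * u ^ m = v ^ i * (v * u) * u ^ j"
    by (simp only: power_Suc2 [of v] power_Suc [of u] mult.assoc)
  then show ?thesis by (simp add: v_u)
qed simp_all

lemma one_in_A_pinf: "1 \<in> (A_pinf p :: (qz \<Rightarrow>\<^sub>0 'k) set)"
  using scale_d_in_A_pinf [of 0 1] S_nn_of_nat [of 0] by (simp add: d_zero)

lemma gsigma_scale_d:
  "a \<in> S_nn p \<Longrightarrow> gsigma p (Poly_Mapping.single 0 c * d a) = Poly_Mapping.single 0 c * d (of_nat p * a)"
  by (simp add: gsigma_mult gsigma_single additive.zero [OF additive_qz_times] gsigma_d)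

lemma grho_scale_d:
  assumes "a \<in> S_nn p"
  shows "grho p (Poly_Mapping.single 0 c * d a) = Poly_Mapping.single 0 c * d ((a + of_nat p - 1) / of_nat p)"
  using grho_gsigma_mult [OF p_pos, of "Poly_Mapping.single 0 c" "d a"] assms
  by (simp add: gsigma_single additive.zero [OF additive_qz_times] grho_d)

lemma S_nn_rho:
  assumes "a \<in> S_nn p"
  shows "(a + of_nat p - 1) / of_nat p \<in> S_nn p"
proof -
  have "(a + of_nat p - 1) / of_nat p = (a + of_nat (p - 1)) * (1 / of_nat p ^ 1)"
    using p_pos by (simp add: of_nat_diff)
  then show ?thesis
    by (simp only: S_nn_mult S_nn_add assms S_nn_of_nat S_nn_inverse_power)
qed

lemma gsigma_in_A_pinf: "x \<in> A_pinf p \<Longrightarrow> gsigma p (x :: qz \<Rightarrow>\<^sub>0 'k) \<in> A_pinf p"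
  by (induction x rule: A_pinf_induct)
    (simp_all add: gsigma_scale_d scale_d_in_A_pinf S_nn_mult S_nn_of_nat additive.add [OF additive_gsigma] A_pinf_add)

lemma grho_in_A_pinf: "x \<in> A_pinf p \<Longrightarrow> grho p (x :: qz \<Rightarrow>\<^sub>0 'k) \<in> A_pinf p"
  by (induction x rule: A_pinf_induct)
    (simp_all add: grho_scale_d scale_d_in_A_pinf S_nn_rho additive.add [OF additive_grho] A_pinf_add)

lemma gsigma_funpow_in_A_pinf: "x \<in> A_pinf p \<Longrightarrow> (gsigma p ^^ n) (x :: qz \<Rightarrow>\<^sub>0 'k) \<in> A_pinf p"
  by (induction n) (simp_all add: gsigma_in_A_pinf)

lemma grho_funpow_in_A_pinf: "x \<in> A_pinf p \<Longrightarrow> (grho p ^^ n) (x :: qz \<Rightarrow>\<^sub>0 'k) \<in> A_pinf p"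
  by (induction n) (simp_all add: grho_in_A_pinf)

lemma tensor_act_in_A_pinf:
  assumes "x \<in> C_p p" "f \<in> A_pinf p"
  shows "tensor_act x (f :: qz \<Rightarrow>\<^sub>0 'k) \<in> A_pinf p"
  using assms unfolding C_p_def
  by (induction x arbitrary: f rule: subalgebra_gen.induct)
    (auto simp: tensor_act_grp_alg tensor_act_u tensor_act_v A_pinf_mult grho_in_A_pinf gsigma_in_A_pinf
      tensor_act_one tensor_act_add A_pinf_add tensor_act_mult tensor_act_tscale scale_in_A_pinf)


section \<open>Normal form of the elements of the $p$-part\<close>

text \<open>The placement of \<open>d b\<close> follows the rules
  \<open>x * u = u * gsigma p x\<close> and \<open>v * x = gsigma p x * v\<close>, which move group
  elements right past \<open>u\<close> and left past \<open>v\<close>. The signed exponent merges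
  both families and counts the words without \<open>u\<close> and \<open>v\<close> once, as
  independence requires.\<close>

definition word :: "int \<times> real \<Rightarrow> (bc, 'k) tensor"
  where "word = (\<lambda>(n, b). if n \<ge> 0 then u ^ nat n * grp_alg (d b) else grp_alg (d b) * v ^ nat (- n))"

definition comb :: "(int \<times> real \<Rightarrow>\<^sub>0 'k) \<Rightarrow> (bc, 'k) tensor"
  where "comb = lext (\<lambda>i c. tscale c (word i))"

text \<open>An image of finitely supported families, not an inductive closure: a member comes with
  coefficients on pairwise distinct words, the form in which independence is tested.\<close>

definition normal_forms :: "(bc, 'k) tensor set"
  where "normal_forms = comb ` {z. Poly_Mapping.keys z \<subseteq> UNIV \<times> S01 p}"

lemma additive_comb: "additive comb"
  unfolding comb_def by (intro additive_lext additive_tscale_left)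

lemma comb_single: "comb (Poly_Mapping.single i c) = tscale c (word i)"
  unfolding comb_def by (intro lext_single additive_tscale_left)

lemma normal_forms_add: "x \<in> normal_forms \<Longrightarrow> y \<in> normal_forms \<Longrightarrow> x + y \<in> normal_forms"
  unfolding normal_forms_def
  by clarify (simp add: keys_add_subset flip: additive.add [OF additive_comb])

lemma zero_in_normal_forms: "0 \<in> normal_forms"
proof -
  have "comb 0 \<in> normal_forms" unfolding normal_forms_def by (intro imageI) simp
  then show ?thesis by (simp add: additive.zero [OF additive_comb])
qed

lemma tscale_word_in_normal_forms: "b \<in> S01 p \<Longrightarrow> tscale c (word (n, b)) \<in> normal_forms"
  unfolding normal_forms_def
  by (rule image_eqI [of _ _ "Poly_Mapping.single (n, b) c"]) (simp_all add: comb_single)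

lemma u_power_grp_in_normal_forms: "x \<in> A_pinf p \<Longrightarrow> u ^ n * grp_alg x \<in> normal_forms"
proof (induction x rule: A_pinf_induct)
  case (d a c)
  then show ?case
    using tscale_word_in_normal_forms [of a c "int n"]
    by (simp add: word_def grp_alg_scale mult_tscale S01_iff)
qed (simp add: additive.add [OF additive_grp_alg] distrib_left normal_forms_add)

lemma grp_v_power_in_normal_forms: "x \<in> A_pinf p \<Longrightarrow> grp_alg x * v ^ n \<in> normal_forms"
proof (induction x rule: A_pinf_induct)
  case (d a c)
  then show ?case
    using tscale_word_in_normal_forms [of a c "- int n"]
    \<comment> \<open>The exponent 0 belongs to the \<open>u\<close> branch of
      \<open>word\<close>.\<close>
    by (cases "n = 0") (simp_all add: word_def grp_alg_scale tscale_mult S01_iff)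
qed (simp add: additive.add [OF additive_grp_alg] distrib_right normal_forms_add)

text \<open>Arbitrary elements of \<open>A_pinf p\<close> replace the scaled deltas, so the product
  computations below need only the closure of \<open>A_pinf p\<close> under the operators and never
  look at words.\<close>

lemma normal_forms_induct [consumes 1, case_names u v add]:
  assumes "x \<in> normal_forms"
    and u: "\<And>n y. y \<in> A_pinf p \<Longrightarrow> P (u ^ n * grp_alg y)"
    and v: "\<And>n y. y \<in> A_pinf p \<Longrightarrow> P (grp_alg y * v ^ n)"
    and add: "\<And>x y. P x \<Longrightarrow> P y \<Longrightarrow> P (x + y)"
  shows "P x"
proof -
  obtain z where z: "x = comb z" "Poly_Mapping.keys z \<subseteq> UNIV \<times> S01 p"
    using assms(1) by (auto simp: normal_forms_def)
  from z(2) have "P (comb z)"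
  proof (induction z rule: poly_mapping_induct)
    case zero
    show ?case
      using u [of 0 0] by (simp add: additive.zero [OF additive_comb] additive.zero [OF additive_grp_alg] A_pinf_def)
  next
    case (single i c)
    then obtain n b where i: "i = (n, b)" "b \<in> S_nn p" by (auto simp: S01_iff)
    have "Poly_Mapping.single 0 c * d b \<in> A_pinf p" using i by (simp add: scale_d_in_A_pinf)
    from u [OF this, of "nat n"] v [OF this, of "nat (- n)"] show ?case
      by (simp add: i word_def comb_single grp_alg_scale tscale_mult mult_tscale)
  qed (simp add: additive.add [OF additive_comb] add)
  then show ?thesis by (simp add: z)
qed

text \<open>Against \<open>u^m\<close>, the factor \<open>x\<close> moves right and becomes its
  \<open>m\<close>-fold \<open>gsigma p\<close> image. Against \<open>v^m\<close>, the common power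
  of \<open>u\<close> and \<open>v\<close> is absorbed by \<open>grho p\<close>, and what remains is
  a pure power on one side.\<close>

lemma u_power_grp_mult_normal_forms:
  assumes x: "x \<in> A_pinf p" and "y \<in> normal_forms"
  shows "u ^ n * grp_alg x * y \<in> normal_forms"
  using assms(2)
proof (induction y rule: normal_forms_induct)
  case (u m y)
  have "u ^ n * grp_alg x * (u ^ m * grp_alg y) = u ^ n * (grp_alg x * u ^ m) * grp_alg y"
    by (simp only: mult.assoc)
  also have "\<dots> = u ^ (n + m) * grp_alg ((gsigma p ^^ m) x * y)"
    by (simp only: grp_u_power mult.assoc power_add grp_alg_mult)
  finally show ?case
    using x u by (simp add: u_power_grp_in_normal_forms A_pinf_mult gsigma_funpow_in_A_pinf)
next
  case (v m y)
  then have xy: "x * y \<in> A_pinf p" using x by (rule A_pinf_mult [rotated])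
  show ?case
  proof (cases "m \<le> n")
    case True
    then obtain k where n: "n = k + m" by (metis le_add_diff_inverse2)
    have "u ^ n * grp_alg x * (grp_alg y * v ^ m) = u ^ k * (u ^ m * grp_alg (x * y) * v ^ m)"
      by (simp only: n power_add mult.assoc grp_alg_mult)
    then show ?thesis
      using xy by (simp add: u_power_grp_v_power u_power_grp_in_normal_forms grho_funpow_in_A_pinf)
  next
    case False
    then obtain k where m: "m = n + k" by (metis le_add_diff_inverse nat_le_linear)
    have "u ^ n * grp_alg x * (grp_alg y * v ^ m) = (u ^ n * grp_alg (x * y) * v ^ n) * v ^ k"
      by (simp only: m power_add mult.assoc grp_alg_mult)
    then show ?thesis
      using xy by (simp add: u_power_grp_v_power grp_v_power_in_normal_forms grho_funpow_in_A_pinf)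
  qed
qed (simp add: distrib_left normal_forms_add)

text \<open>The critical product \<open>v^n * u^m\<close> vanishes as soon as both exponents are
  positive, by \<open>v * u = 0\<close>.\<close>

lemma grp_v_power_mult_normal_forms:
  assumes x: "x \<in> A_pinf p" and "y \<in> normal_forms"
  shows "grp_alg x * v ^ n * y \<in> normal_forms"
  using assms(2)
proof (induction y rule: normal_forms_induct)
  case (u m y)
  then show ?case
  proof (cases "n = 0 \<or> m = 0")
    case True
    then show ?thesis
    proof
      assume "n = 0"
      then show ?thesis
        using u_power_grp_mult_normal_forms [OF x u_power_grp_in_normal_forms [OF u], of 0 m]
        by simp
    next
      assume "m = 0"
      moreover have "grp_alg x * v ^ n * grp_alg y = grp_alg (x * (gsigma p ^^ n) y) * v ^ n"
        by (simp only: mult.assoc v_power_grp grp_alg_mult)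
      ultimately show ?thesis
        using x u by (simp add: grp_v_power_in_normal_forms A_pinf_mult gsigma_funpow_in_A_pinf)
    qed
  next
    case False
    have "grp_alg x * v ^ n * (u ^ m * grp_alg y) = grp_alg x * (v ^ n * u ^ m) * grp_alg y"
      by (simp only: mult.assoc)
    then show ?thesis using False by (simp add: v_power_u_power zero_in_normal_forms)
  qed
next
  case (v m y)
  have "grp_alg x * v ^ n * (grp_alg y * v ^ m) = grp_alg x * (v ^ n * grp_alg y) * v ^ m"
    by (simp only: mult.assoc)
  also have "\<dots> = grp_alg (x * (gsigma p ^^ n) y) * v ^ (n + m)"
    by (simp only: mult.assoc v_power_grp grp_alg_mult power_add)
  finally show ?case
    using x v by (simp add: grp_v_power_in_normal_forms A_pinf_mult gsigma_funpow_in_A_pinf)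
qed (simp add: distrib_left normal_forms_add)

lemma normal_forms_mult: "x \<in> normal_forms \<Longrightarrow> y \<in> normal_forms \<Longrightarrow> x * y \<in> normal_forms"
  by (induction x rule: normal_forms_induct)
    (simp_all add: u_power_grp_mult_normal_forms grp_v_power_mult_normal_forms distrib_right normal_forms_add)

lemma C_p_subset_normal_forms: "C_p p \<subseteq> normal_forms"
proof
  fix x :: "(bc, 'k) tensor"
  have grp: "grp_alg x \<in> normal_forms" if "x \<in> A_pinf p" for x
    using u_power_grp_in_normal_forms [OF that, of 0] by simp
  assume "x \<in> C_p p"
  then show "x \<in> normal_forms"
    unfolding C_p_def
  proof (induction x rule: subalgebra_gen.induct)
    case (sg_gen x)
    have "u \<in> normal_forms"
      using u_power_grp_in_normal_forms [OF one_in_A_pinf, of 1] by (simp add: grp_alg_one)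
    moreover have "v \<in> normal_forms"
      using grp_v_power_in_normal_forms [OF one_in_A_pinf, of 1] by (simp add: grp_alg_one)
    ultimately show ?case using sg_gen grp by auto
  next
    case sg_one
    show ?case using grp [OF one_in_A_pinf] by (simp add: grp_alg_one)
  next
    case (sg_scale x c)
    \<comment> \<open>Scaling is left multiplication by a constant of the group algebra, hence
      covered by closure under products.\<close>
    have "grp_alg (Poly_Mapping.single 0 c * 1) \<in> normal_forms"
      by (intro grp scale_in_A_pinf one_in_A_pinf)
    then have "tscale c 1 \<in> normal_forms" by (simp only: grp_alg_scale grp_alg_one)
    then have "tscale c 1 * x \<in> normal_forms" using sg_scale normal_forms_mult by blast
    then show ?case by (simp add: tscale_mult)
  qed (simp_all add: normal_forms_add normal_forms_mult)
qed

end

section \<open>Independence of the words\<close>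

context char_p
begin

definition wslope :: "int \<times> real \<Rightarrow> real"
  where "wslope = (\<lambda>(n, b). of_nat p powi (- n))"

text \<open>For \<open>n \<ge> 0\<close> the word first shifts the exponent by \<open>b\<close> and
  then applies \<open>grho p\<close> \<open>n\<close> times; otherwise it first multiplies by a
  power of \<open>p\<close> and then shifts by \<open>b\<close>.\<close>

definition woffset :: "int \<times> real \<Rightarrow> real"
  where "woffset = (\<lambda>(n, b). if n \<ge> 0 then 1 - (1 - b) / of_nat p ^ nat n else b)"

definition wmap :: "int \<times> real \<Rightarrow> real \<Rightarrow> real"
  where "wmap i a = woffset i + wslope i * a"

text \<open>The map \<open>a \<mapsto> (a + p - 1) / p\<close> fixes 1 and divides the distance
  \<open>1 - a\<close> by \<open>p\<close>.\<close>

lemma grho_funpow_d: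
  assumes "a \<in> S_nn p"
  shows "(grho p ^^ n) (d a) = d (1 - (1 - a) / of_nat p ^ n)" "1 - (1 - a) / of_nat p ^ n \<in> S_nn p"
proof -
  have "(grho p ^^ n) (d a) = d (1 - (1 - a) / of_nat p ^ n) \<and> 1 - (1 - a) / of_nat p ^ n \<in> S_nn p"
  proof (induction n)
    case (Suc n)
    have "(1 - (1 - a) / of_nat p ^ n + of_nat p - 1) / of_nat p = 1 - (1 - a) / of_nat p ^ Suc n"
      using p_pos by (simp add: field_simps)
    then show ?case using Suc grho_d S_nn_rho by (metis funpow.simps(2) o_apply)
  qed (use assms in simp)
  then show "(grho p ^^ n) (d a) = d (1 - (1 - a) / of_nat p ^ n)" "1 - (1 - a) / of_nat p ^ n \<in> S_nn p"
    by auto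
qed

lemma S_nn_power: "of_nat p ^ n \<in> S_nn p"
  using S_nn_of_nat [of "p ^ n"] by simp

lemma gsigma_funpow_d:
  assumes "a \<in> S_nn p"
  shows "(gsigma p ^^ n) (d a) = d (of_nat p ^ n * a)"
proof (induction n)
  case (Suc n)
  then show ?case
    using gsigma_d [OF S_nn_mult [OF S_nn_power assms]] by (simp add: mult.assoc)
qed simp

lemma tensor_act_u_power: "tensor_act (u ^ n) f = (grho p ^^ n) f"
  by (induction n) (simp_all add: tensor_act_one tensor_act_mult tensor_act_u)

lemma tensor_act_v_power: "tensor_act (v ^ n) f = (gsigma p ^^ n) f"
  by (induction n) (simp_all add: tensor_act_one tensor_act_mult tensor_act_v)

lemma tensor_act_word:
  assumes "b \<in> S_nn p" "a \<in> S_nn p"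
  shows "tensor_act (word (n, b)) (d a) = d (wmap (n, b) a)" "wmap (n, b) a \<in> S_nn p"
proof -
  have "tensor_act (word (n, b)) (d a) = d (wmap (n, b) a) \<and> wmap (n, b) a \<in> S_nn p"
  proof (cases "n \<ge> 0")
    case True
    then have "wmap (n, b) a = 1 - (1 - (b + a)) / of_nat p ^ nat n"
      using p_pos by (simp add: wmap_def woffset_def wslope_def power_int_minus power_int_def field_simps)
    then show ?thesis
      using True assms grho_funpow_d [OF S_nn_add [OF assms]]
      by (simp add: word_def tensor_act_mult tensor_act_u_power tensor_act_grp_alg d_mult)
  next
    case False
    then have "wmap (n, b) a = b + of_nat p ^ nat (- n) * a"
      by (simp add: wmap_def woffset_def wslope_def power_int_def)
    then show ?thesis
      using False assms S_nn_mult [OF S_nn_power assms(2)]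
      by (simp add: word_def tensor_act_mult tensor_act_v_power tensor_act_grp_alg gsigma_funpow_d
          d_mult S_nn_add)
  qed
  then show "tensor_act (word (n, b)) (d a) = d (wmap (n, b) a)" "wmap (n, b) a \<in> S_nn p"
    by auto
qed

lemma p_gt_one: "real p > 1"
  using prime_gt_1_nat [OF prime] by simp

text \<open>The test points \<open>1 / p^l\<close> are exponents and tend to 0, so finitely many
  conditions that hold eventually hold at a common one.\<close>

lemma wmap_tendsto: "(\<lambda>l. wmap i (1 / of_nat p ^ l)) \<longlonglongrightarrow> woffset i"
  using tendsto_add [OF tendsto_const [of "woffset i"]
      tendsto_mult [OF tendsto_const [of "wslope i"] LIMSEQ_divide_realpow_zero [OF p_gt_one, of 1]]]
  by (simp add: wmap_def)

text \<open>Different offsets are different limits. With equal offsets the exponents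
  \<open>n\<close> and \<open>m\<close> must differ, because for fixed \<open>n\<close> the offset
  determines \<open>b\<close>; then the slopes differ and the maps disagree at every positive
  point.\<close>

lemma wmap_eventually_neq:
  assumes "i \<noteq> j"
  shows "\<forall>\<^sub>F l in sequentially. wmap i (1 / of_nat p ^ l) \<noteq> wmap j (1 / of_nat p ^ l)"
proof (cases "woffset i = woffset j")
  case True
  obtain n b m c where ij: "i = (n, b)" "j = (m, c)" by fastforce
  have "n \<noteq> m"
  proof
    assume "n = m"
    then have "b = c"
      using True p_pos by (auto simp: ij woffset_def split: if_splits)
    then show False using assms \<open>n = m\<close> ij by simp
  qed
  then have "of_nat p powi (- n) \<noteq> (of_nat p powi (- m) :: real)"
    using p_gt_one by (metis neg_equal_iff_equal power_int_strict_increasing less_irrefl linorder_neqE)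
  then have "wslope i \<noteq> wslope j" by (simp add: wslope_def ij)
  then have "wmap i (1 / of_nat p ^ l) \<noteq> wmap j (1 / of_nat p ^ l)" for l
    using True p_pos by (simp add: wmap_def divide_simps)
  then show ?thesis by simp
next
  case False
  have "(\<lambda>l. wmap i (1 / of_nat p ^ l) - wmap j (1 / of_nat p ^ l)) \<longlonglongrightarrow> woffset i - woffset j"
    by (intro tendsto_diff wmap_tendsto)
  from tendsto_imp_eventually_ne [OF this, of 0] False show ?thesis
    by (auto elim: eventually_mono)
qed

text \<open>Keeps the images clear of truncation: \<open>b < 1\<close> makes the limit,
  \<open>woffset (n, b)\<close>, strictly less than 1.\<close>

lemma wmap_eventually_less_one:
  assumes "b < 1"
  shows "\<forall>\<^sub>F l in sequentially. wmap (n, b) (1 / of_nat p ^ l) < 1"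
  using assms p_pos by (intro order_tendstoD(2) [OF wmap_tendsto]) (simp add: woffset_def)

text \<open>At a good test point the words in \<open>x\<close> send \<open>d a\<close> to deltas
  with distinct exponents below 1, which are independent by \<open>Phi_eq_0\<close>.\<close>

lemma normal_forms_faithful:
  assumes "x \<in> normal_forms" and zero: "\<And>f. f \<in> A_pinf p \<Longrightarrow> tensor_act x f = 0"
  shows "x = 0"
proof -
  obtain z where x: "x = comb z" and z: "Poly_Mapping.keys z \<subseteq> UNIV \<times> S01 p"
    using assms(1) by (auto simp: normal_forms_def)
  define I where "I = Poly_Mapping.keys z"
  have I: "finite I" by (simp add: I_def)
  have "\<forall>\<^sub>F l in sequentially. \<forall>i\<in>I. wmap i (1 / of_nat p ^ l) < 1"
  proof (intro eventually_ball_finite I ballI)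
    fix i assume "i \<in> I"
    then obtain n b where "i = (n, b)" "b < 1" using z by (auto simp: I_def S01_iff)
    then show "\<forall>\<^sub>F l in sequentially. wmap i (1 / of_nat p ^ l) < 1"
      by (simp add: wmap_eventually_less_one)
  qed
  moreover have "\<forall>\<^sub>F l in sequentially. \<forall>i\<in>I. \<forall>j\<in>I. i \<noteq> j \<longrightarrow>
      wmap i (1 / of_nat p ^ l) \<noteq> wmap j (1 / of_nat p ^ l)"
  proof (intro eventually_ball_finite I ballI)
    show "\<forall>\<^sub>F l in sequentially. i \<noteq> j \<longrightarrow> wmap i (1 / of_nat p ^ l) \<noteq> wmap j (1 / of_nat p ^ l)" for i j
      by (cases "i = j") (simp_all add: wmap_eventually_neq)
  qed
  ultimately have "\<forall>\<^sub>F l in sequentially. (\<forall>i\<in>I. wmap i (1 / of_nat p ^ l) < 1) \<and>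
      (\<forall>i\<in>I. \<forall>j\<in>I. i \<noteq> j \<longrightarrow> wmap i (1 / of_nat p ^ l) \<noteq> wmap j (1 / of_nat p ^ l))"
    by (rule eventually_conj)
  then obtain l where l: "\<And>i. i \<in> I \<Longrightarrow> wmap i (1 / of_nat p ^ l) < 1"
      "inj_on (\<lambda>i. wmap i (1 / of_nat p ^ l)) I"
    using eventually_happens' [OF sequentially_bot] unfolding inj_on_def by blast
  define a where "a = 1 / real p ^ l"
  have a: "a \<in> S_nn p" unfolding a_def by (rule S_nn_inverse_power)
  have act: "tensor_act (word i) (d a) = d (wmap i a)" "wmap i a \<in> S01 p" if "i \<in> I" for i
  proof -
    have "i \<in> UNIV \<times> S01 p" using that z unfolding I_def by blast
    then obtain n b where i: "i = (n, b)" "b \<in> S_nn p" by (auto simp: S01_iff)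
    show "tensor_act (word i) (d a) = d (wmap i a)" "wmap i a \<in> S01 p"
      using tensor_act_word [OF i(2) a] l(1) [OF that] by (simp_all add: i S01_iff a_def)
  qed
  \<comment> \<open>The vector that \<open>Phi p\<close> maps to the value of \<open>x\<close> at
    \<open>d a\<close>; as the exponents are distinct, its coefficient at \<open>wmap j a\<close> is
    exactly the coefficient of \<open>z\<close> at \<open>j\<close>.\<close>
  define f where "f = (\<Sum>i\<in>I. Poly_Mapping.single (wmap i a) (Poly_Mapping.lookup z i))"
  have "tensor_act x (d a) = (\<Sum>i\<in>I. Poly_Mapping.single 0 (Poly_Mapping.lookup z i) * d (wmap i a))"
    by (simp add: x comb_def lext_def I_def [symmetric] additive.sum [OF additive_tensor_act_left]
        tensor_act_tscale act)
  also have "\<dots> = Phi p f"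
    by (simp add: f_def additive.sum [OF additive_Phi] Phi_single)
  finally have "Phi p f = 0"
    using zero scale_d_in_A_pinf [OF a, of 1] by simp
  moreover have "f \<in> V_space p"
    unfolding f_def V_space_def using act(2)
    by (intro CollectI order_trans [OF keys_sum]) auto
  ultimately have "f = 0" by (intro Phi_eq_0)
  have "I = {}"
  proof (rule ccontr)
    assume "I \<noteq> {}"
    then obtain j where j: "j \<in> I" by blast
    have "Poly_Mapping.lookup f (wmap j a) = (\<Sum>i\<in>I. if i = j then Poly_Mapping.lookup z i else 0)"
      unfolding f_def lookup_sum lookup_single when_def
      using inj_onD [OF l(2)] j by (intro sum.cong) (auto simp: a_def)
    then have "Poly_Mapping.lookup z j = 0"
      using j I \<open>f = 0\<close> by simp
    then show False using j by (simp add: I_def in_keys_iff)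
  qed
  then show "x = 0"
    using additive.zero [OF additive_comb] by (simp add: x I_def)
qed

lemma uminus_in_C_p: "x \<in> C_p p \<Longrightarrow> - x \<in> (C_p p :: (bc, 'k) tensor set)"
  using sg_scale [of x _ "- 1"]
  by (simp add: C_p_def additive.minus [OF additive_tscale_left] tscale_one)

lemma C_p_faithful:
  assumes "x \<in> C_p p" "y \<in> C_p p"
    and "\<And>f. f \<in> A_pinf p \<Longrightarrow> tensor_act x f = tensor_act y f"
  shows "x = (y :: (bc, 'k) tensor)"
proof -
  have "x + - y \<in> C_p p"
    using assms(1) uminus_in_C_p [OF assms(2)] unfolding C_p_def by (rule sg_add)
  then have "x - y \<in> normal_forms" using C_p_subset_normal_forms by auto
  then have "x - y = 0"
    by (rule normal_forms_faithful) (simp add: assms(3) additive.diff [OF additive_tensor_act_left])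
  then show ?thesis by simp
qed

end

section \<open>The representation\<close>

lemma vscale_eq: "vscale c f = Poly_Mapping.single 0 c * f"
  by (simp add: vscale_def mult_map_scale_conv_mult)

lemma vscale_single: "vscale c (Poly_Mapping.single a b) = Poly_Mapping.single a (c * b)"
  by (simp add: vscale_eq mult_single)

lemma vscale_in_V_space: "f \<in> V_space p \<Longrightarrow> vscale c f \<in> V_space p"
  by (simp add: V_space_def vscale_eq keys_scale_subset)

lemma add_in_V_space: "f \<in> V_space p \<Longrightarrow> g \<in> V_space p \<Longrightarrow> f + g \<in> V_space p"
  by (simp add: V_space_def keys_add_subset)

lemma keys_vscale_subset: "Poly_Mapping.keys f \<subseteq> A \<Longrightarrow> Poly_Mapping.keys (vscale c f) \<subseteq> A"
  by (simp add: vscale_eq keys_scale_subset)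

text \<open>\<open>K\<close> records where the support lies: everything for linearity arguments, a
  half-line for triangularity.\<close>

lemma End_V_induct [consumes 2, case_names zero xi add scale]:
  fixes f :: "real \<Rightarrow>\<^sub>0 'a::field"
  assumes "f \<in> V_space p" "Poly_Mapping.keys f \<subseteq> K"
    and "P 0" "\<And>a. a \<in> S01 p \<Longrightarrow> a \<in> K \<Longrightarrow> P (xi a)"
    and "\<And>f g. f \<in> V_space p \<Longrightarrow> g \<in> V_space p \<Longrightarrow> P f \<Longrightarrow> P g \<Longrightarrow> P (f + g)"
    and "\<And>c f. f \<in> V_space p \<Longrightarrow> P f \<Longrightarrow> P (vscale c f)"
  shows "P f"
proof -
  have "Poly_Mapping.keys f \<subseteq> S01 p \<inter> K" using assms(1,2) by (simp add: V_space_def)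
  then have "f \<in> V_space p \<and> P f"
  proof (induction f rule: poly_mapping_induct)
    case (single a c)
    then have "Poly_Mapping.single a c = vscale c (xi a)" "(xi a :: real \<Rightarrow>\<^sub>0 'a) \<in> V_space p"
      by (simp_all add: xi_def S01_def V_space_def vscale_single)
    then show ?case using single assms(4,6) by (simp add: vscale_in_V_space)
  qed (simp_all add: assms(3,5) add_in_V_space, simp add: V_space_def)
  then show ?thesis ..
qed

lemma End_V_zero: "T \<in> End_V p \<Longrightarrow> T 0 = 0"
proof -
  assume "T \<in> End_V p"
  moreover have "0 \<in> V_space p" by (simp add: V_space_def)
  ultimately have "T (0 + 0) = T 0 + T 0" unfolding End_V_def by blast
  then show "T 0 = 0" by (simp only: add_0_right add_cancel_right_right)
qed

lemma End_V_add: "T \<in> End_V p \<Longrightarrow> f \<in> V_space p \<Longrightarrow> g \<in> V_space p \<Longrightarrow> T (f + g) = T f + T g"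
  by (simp add: End_V_def)

lemma End_V_vscale: "T \<in> End_V p \<Longrightarrow> f \<in> V_space p \<Longrightarrow> T (vscale c f) = vscale c (T f)"
  by (simp add: End_V_def)

lemma End_V_in_V_space: "T \<in> End_V p \<Longrightarrow> f \<in> V_space p \<Longrightarrow> T f \<in> V_space p"
  by (auto simp: End_V_def)

lemma End_V_eqI:
  assumes "T \<in> End_V p" "T' \<in> End_V p" "\<And>a. a \<in> S01 p \<Longrightarrow> T (xi a) = T' (xi a)"
  shows "T = T'"
proof (rule extensionalityI)
  show "T \<in> extensional (V_space p)" "T' \<in> extensional (V_space p)"
    using assms by (auto simp: End_V_def PiE_def)
  fix f :: "real \<Rightarrow>\<^sub>0 'a" assume "f \<in> V_space p"
  then show "T f = T' f"
    using subset_UNIV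
    by (induction f rule: End_V_induct)
      (simp_all add: assms End_V_zero [OF assms(1)] End_V_zero [OF assms(2)] End_V_add [OF assms(1)] End_V_add [OF assms(2)]
        End_V_vscale [OF assms(1)] End_V_vscale [OF assms(2)])
qed

lemma End_V_matrix:
  assumes "T \<in> End_V p"
  shows "is_matrix_of p (\<lambda>a b. Poly_Mapping.lookup (T (xi b)) a) T"
  unfolding is_matrix_of_def
proof (intro ballI)
  fix f :: "real \<Rightarrow>\<^sub>0 'a" and a
  assume f: "f \<in> V_space p"
  \<comment> \<open>The right-hand side of the matrix equation as a function of \<open>f\<close>; as
    a \<open>lext\<close> it is additive although its range of summation depends on
    \<open>f\<close>.\<close>
  define F where "F = lext (\<lambda>b c. Poly_Mapping.lookup (T (xi b)) a * c)"
  have F_single: "F (Poly_Mapping.single b c) = Poly_Mapping.lookup (T (xi b)) a * c" for b c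
    unfolding F_def by (intro lext_single additive_intros)
  have F: "additive F"
    unfolding F_def by (intro additive_lext additive_intros)
  have F_vscale: "F (vscale c f) = c * F f" for c f
    by (rule additive_eqI_UNIV)
      (simp_all add: additive_def vscale_eq distrib_left additive.add [OF F] F_single mult_single mult.left_commute)
  from f subset_UNIV have "Poly_Mapping.lookup (T f) a = F f"
  proof (induction f rule: End_V_induct)
    case (xi b)
    then show ?case by (simp add: xi_def S01_def F_single)
  next
    case (scale c f)
    then show ?case unfolding End_V_vscale [OF assms scale(1)] F_vscale by (simp add: vscale_eq lookup_scale)
  qed (simp_all add: End_V_zero [OF assms] End_V_add [OF assms] additive.zero [OF F] additive.add [OF F] lookup_add)
  then show "Poly_Mapping.lookup (T f) a
      = (\<Sum>b\<in>Poly_Mapping.keys f. Poly_Mapping.lookup (T (xi b)) a * Poly_Mapping.lookup f b)"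
    by (simp add: F_def lext_def)
qed

text \<open>Turns a condition on basis vectors into invariance of the vectors supported in
  \<open>{t..}\<close>, a property that passes to compositions.\<close>

lemma End_V_keys_lower_bound:
  assumes "T \<in> End_V p" "\<And>a. a \<in> S01 p \<Longrightarrow> Poly_Mapping.keys (T (xi a)) \<subseteq> {a..}"
    and "f \<in> V_space p" "Poly_Mapping.keys f \<subseteq> {t..}"
  shows "Poly_Mapping.keys (T f) \<subseteq> {t..}"
  using assms(3,4)
proof (induction f rule: End_V_induct)
  case (xi a)
  then show ?case using assms(2) [of a] by auto
qed (simp_all add: End_V_zero [OF assms(1)] End_V_add [OF assms(1)] End_V_vscale [OF assms(1)]
    keys_add_subset keys_vscale_subset)

context char_p
begin

lemma xi_in_V_space: "a \<in> S_nn p \<Longrightarrow> xi a \<in> V_space p"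
  by (simp add: xi_def V_space_def S01_iff)

lemma Phi_xi: "a \<in> S_nn p \<Longrightarrow> Phi p (xi a) = d a"
  by (simp add: xi_def Phi_single additive.zero [OF additive_Phi] d_ge_one)

lemma Phi_vscale: "Phi p (vscale c f) = Poly_Mapping.single 0 c * (Phi p f :: qz \<Rightarrow>\<^sub>0 'k)"
  by (rule additive_eqI_UNIV)
    (simp_all add: additive_def vscale_eq distrib_left additive.add [OF additive_Phi] Phi_single mult_single
      flip: mult.assoc)

lemma Phi_in_A_pinf: "f \<in> V_space p \<Longrightarrow> Phi p f \<in> (A_pinf p :: (qz \<Rightarrow>\<^sub>0 'k) set)"
  by (simp flip: Phi_image)

text \<open>Scalars are the action of the central elements \<open>1 \<otimes> c\<close>.\<close>

lemma tensor_act_scale: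
  "tensor_act x (Poly_Mapping.single 0 c * f) = Poly_Mapping.single 0 c * tensor_act x (f :: qz \<Rightarrow>\<^sub>0 'k)"
proof -
  have "tensor_act (1 \<otimes> c) g = Poly_Mapping.single 0 c * g" for g
    by (simp add: tensor_act_of bc_act_one)
  then show ?thesis
    by (metis one_tensor_central tensor_act_mult)
qed

text \<open>\<open>restrict\<close> makes the values extensional, as \<open>End_V\<close> demands.
  Outside \<open>C_p p\<close> the action can leave the image of \<open>Phi p\<close>, and
  \<open>inv_into\<close> is then unspecified.\<close>

definition theta :: "(bc, 'k) tensor \<Rightarrow> (real \<Rightarrow>\<^sub>0 'k) \<Rightarrow> (real \<Rightarrow>\<^sub>0 'k)"
  where "theta x = restrict (\<lambda>f. inv_into (V_space p) (Phi p) (tensor_act x (Phi p f))) (V_space p)"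

lemma theta_eqI:
  assumes "f \<in> V_space p" "g \<in> V_space p" "tensor_act x (Phi p f) = Phi p g"
  shows "theta x f = g"
  using assms by (simp add: theta_def inv_into_f_f [OF inj_on_Phi])

lemma Phi_theta:
  assumes "x \<in> C_p p" "f \<in> V_space p"
  shows "theta x f \<in> V_space p" "Phi p (theta x f) = tensor_act x (Phi p f)"
proof -
  have "tensor_act x (Phi p f) \<in> Phi p ` V_space p"
    unfolding Phi_image using assms by (intro tensor_act_in_A_pinf Phi_in_A_pinf)
  then show "theta x f \<in> V_space p" "Phi p (theta x f) = tensor_act x (Phi p f)"
    using assms(2) by (simp_all add: theta_def inv_into_into f_inv_into_f)
qed

lemma theta_in_End_V:
  assumes "x \<in> C_p p"
  shows "theta x \<in> End_V p"
proof -
  have "theta x (f + g) = theta x f + theta x g" if "f \<in> V_space p" "g \<in> V_space p" for f g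
    using Phi_theta [OF assms that(1)] Phi_theta [OF assms that(2)] that
    by (intro theta_eqI) (simp_all add: add_in_V_space additive.add [OF additive_Phi] additive.add [OF additive_tensor_act])
  moreover have "theta x (vscale c f) = vscale c (theta x f)" if f: "f \<in> V_space p" for c f
  proof (rule theta_eqI)
    show "tensor_act x (Phi p (vscale c f)) = Phi p (vscale c (theta x f))"
      using Phi_theta [OF assms f] by (simp add: Phi_vscale tensor_act_scale)
  qed (use f Phi_theta [OF assms f] in \<open>simp_all add: vscale_in_V_space\<close>)
  moreover have "theta x \<in> V_space p \<rightarrow>\<^sub>E V_space p"
    using Phi_theta(1) [OF assms] by (auto simp: theta_def)
  ultimately show ?thesis by (simp add: End_V_def)
qed

lemma is_representation_theta: "is_representation p theta"
  unfolding is_representation_def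
proof (intro conjI ballI allI)
  show "theta \<in> C_p p \<rightarrow> End_V p" using theta_in_End_V by blast
  fix f :: "real \<Rightarrow>\<^sub>0 'k" assume f: "f \<in> V_space p"
  show "theta 1 f = f"
    using f by (intro theta_eqI) (simp_all add: tensor_act_one)
  fix x :: "(bc, 'k) tensor" assume x: "x \<in> C_p p"
  show "theta (tscale c x) f = vscale c (theta x f)" for c
    using f Phi_theta [OF x f] by (intro theta_eqI) (simp_all add: vscale_in_V_space Phi_vscale tensor_act_tscale)
  fix y :: "(bc, 'k) tensor" assume y: "y \<in> C_p p"
  show "theta (x + y) f = theta x f + theta y f"
    using f Phi_theta [OF x f] Phi_theta [OF y f]
    by (intro theta_eqI) (simp_all add: add_in_V_space additive.add [OF additive_Phi] tensor_act_add)
  show "theta (x * y) f = theta x (theta y f)"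
    using f Phi_theta [OF y f] Phi_theta [OF x Phi_theta(1) [OF y f]]
    by (intro theta_eqI) (simp_all add: tensor_act_mult)
qed

lemma theta_equations_theta: "theta_equations p theta"
  unfolding theta_equations_def
proof (intro conjI ballI)
  fix a assume a: "a \<in> S01 p"
  then have a': "a \<in> S_nn p" by (simp add: S01_iff)
  show "theta u (xi a) = xi ((a + of_nat p - 1) / of_nat p)"
    using a' by (intro theta_eqI) (simp_all add: xi_in_V_space S_nn_rho Phi_xi tensor_act_u grho_d)
  show "theta v (xi a) = xi (of_nat p * a)"
    using a' by (intro theta_eqI) (simp_all add: xi_in_V_space S_nn_mult S_nn_of_nat Phi_xi tensor_act_v gsigma_d)
  fix b assume "b \<in> S01 p"
  then have "b \<in> S_nn p" by (simp add: S01_iff)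
  then show "theta (grp_alg (d b)) (xi a) = xi (a + b)"
    using a' by (intro theta_eqI) (simp_all add: xi_in_V_space S_nn_add Phi_xi tensor_act_grp_alg d_mult add.commute)
qed

lemma inj_on_theta: "inj_on theta (C_p p)"
proof
  fix x y :: "(bc, 'k) tensor"
  assume x: "x \<in> C_p p" and y: "y \<in> C_p p" and eq: "theta x = theta y"
  show "x = y"
  proof (rule C_p_faithful [OF x y])
    fix f :: "qz \<Rightarrow>\<^sub>0 'k" assume "f \<in> A_pinf p"
    then obtain g where "g \<in> V_space p" "f = Phi p g" unfolding Phi_image [symmetric] by blast
    then show "tensor_act x f = tensor_act y f"
      using Phi_theta(2) [OF x] Phi_theta(2) [OF y] eq by metis
  qed
qed

section \<open>Uniqueness and triangularity, by induction over the generators\<close>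

lemma grp_alg_in_C_p: "x \<in> A_pinf p \<Longrightarrow> grp_alg x \<in> C_p p"
  by (simp add: C_p_def sg_gen)

lemma u_in_C_p: "u \<in> C_p p" and v_in_C_p: "v \<in> C_p p"
  by (simp_all add: C_p_def sg_gen)

text \<open>The group algebra generators are cut down to the deltas, which span it and on which the
  equations prescribe the values. Membership in \<open>C_p p\<close> is carried along because the
  laws of a representation hold only there.\<close>

lemma C_p_induct [consumes 1, case_names d u v one add mult scale]:
  assumes "x \<in> C_p p"
    and d: "\<And>a. a \<in> S01 p \<Longrightarrow> P (grp_alg (d a))" and "P u" "P v" "P 1"
    and add: "\<And>x y. x \<in> C_p p \<Longrightarrow> y \<in> C_p p \<Longrightarrow> P x \<Longrightarrow> P y \<Longrightarrow> P (x + y)"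
    and "\<And>x y. x \<in> C_p p \<Longrightarrow> y \<in> C_p p \<Longrightarrow> P x \<Longrightarrow> P y \<Longrightarrow> P (x * y)"
    and scale: "\<And>c x. x \<in> C_p p \<Longrightarrow> P x \<Longrightarrow> P (tscale c x)"
  shows "P x"
proof -
  have grp: "grp_alg y \<in> C_p p \<and> P (grp_alg y)" if "y \<in> A_pinf p" for y
    using that
  proof (induction y rule: A_pinf_induct)
    case (d a c)
    moreover from this have "grp_alg (d a) \<in> C_p p"
      using scale_d_in_A_pinf [of a 1] by (simp add: grp_alg_in_C_p)
    ultimately show ?case
      by (simp add: S01_iff assms(2) grp_alg_scale scale) (simp add: C_p_def sg_scale)
  next
    case (add x y)
    then show ?case
      by (simp add: additive.add [OF additive_grp_alg] assms(6)) (simp add: C_p_def sg_add)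
  qed
  from assms(1) show ?thesis
    unfolding C_p_def
  proof (induction x rule: subalgebra_gen.induct)
    case (sg_gen x)
    then show ?case using grp assms(3,4) by blast
  qed (use assms(5-8) in \<open>auto simp: C_p_def\<close>)
qed

lemma zero_in_V_space: "0 \<in> V_space p"
  by (simp add: V_space_def)

lemma representation_one: "is_representation p \<theta> \<Longrightarrow> f \<in> V_space p \<Longrightarrow> \<theta> 1 f = f"
  unfolding is_representation_def by blast

lemma representation_rules:
  assumes "is_representation p \<theta>" "x \<in> C_p p" "f \<in> V_space p"
  shows "\<theta> x \<in> End_V p" "\<theta> (tscale c x) f = vscale c (\<theta> x f :: real \<Rightarrow>\<^sub>0 'k)"
    and "y \<in> C_p p \<Longrightarrow> \<theta> (x + y) f = \<theta> x f + \<theta> y f"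
    and "y \<in> C_p p \<Longrightarrow> \<theta> (x * y) f = \<theta> x (\<theta> y f)"
  using assms unfolding is_representation_def by blast+

lemma theta_equations_rules:
  assumes "theta_equations p \<theta>" "a \<in> S01 p"
  shows "b \<in> S01 p \<Longrightarrow> \<theta> (grp_alg (d b)) (xi a) = xi (a + b)"
    and "\<theta> u (xi a) = xi ((a + of_nat p - 1) / of_nat p)"
    and "\<theta> v (xi a) = xi (of_nat p * a)"
  using assms unfolding theta_equations_def by blast+

lemma xi_in_V_space': "a \<in> S01 p \<Longrightarrow> xi a \<in> (V_space p :: (real \<Rightarrow>\<^sub>0 'k) set)"
  by (simp add: xi_in_V_space S01_iff)

text \<open>Endomorphisms are determined by the basis vectors \<open>xi a\<close>, the equations fix
  them on generators, and agreement passes through sums, products and scalars.\<close>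

lemma representation_unique:
  assumes \<theta>: "is_representation p \<theta>" "theta_equations p \<theta>"
    and \<theta>': "is_representation p \<theta>'" "theta_equations p \<theta>'" and "x \<in> C_p p"
  shows "\<theta>' x = (\<theta> x :: (real \<Rightarrow>\<^sub>0 'k) \<Rightarrow> _)"
proof -
  have ext: "\<theta>' x = \<theta> x"
    if "x \<in> C_p p" "\<And>f. f \<in> V_space p \<Longrightarrow> \<exists>a. f = xi a \<and> a \<in> S01 p \<Longrightarrow> \<theta>' x f = \<theta> x f" for x
    using that xi_in_V_space'
    by (intro End_V_eqI [of _ p] representation_rules(1) [OF \<theta>(1) _ zero_in_V_space]
        representation_rules(1) [OF \<theta>'(1) _ zero_in_V_space]) auto
  from assms(5) show ?thesis
  proof (induction x rule: C_p_induct)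
    case (d b)
    then have "grp_alg (d b) \<in> C_p p"
      using scale_d_in_A_pinf [of b 1] by (simp add: grp_alg_in_C_p S01_iff)
    then show ?case
      using d by (intro ext)
        (auto simp: theta_equations_rules [OF \<theta>(2)] theta_equations_rules [OF \<theta>'(2)])
  next
    case u
    show ?case
      by (intro ext u_in_C_p) (auto simp: theta_equations_rules [OF \<theta>(2)] theta_equations_rules [OF \<theta>'(2)])
  next
    case v
    show ?case
      by (intro ext v_in_C_p) (auto simp: theta_equations_rules [OF \<theta>(2)] theta_equations_rules [OF \<theta>'(2)])
  next
    case one
    have "1 \<in> C_p p" by (simp add: C_p_def sg_one)
    then show ?case
      by (intro ext) (simp_all add: representation_one [OF \<theta>(1)] representation_one [OF \<theta>'(1)])
  next
    case (add x y)
    then have "x + y \<in> C_p p" by (simp add: C_p_def sg_add)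
    then show ?case
      using add by (intro ext) (simp_all add: representation_rules(3) [OF \<theta>(1)] representation_rules(3) [OF \<theta>'(1)])
  next
    case (mult x y)
    then have "x * y \<in> C_p p" by (simp add: C_p_def sg_mult)
    then show ?case
      using mult by (intro ext) (simp_all add: representation_rules(4) [OF \<theta>(1)] representation_rules(4) [OF \<theta>'(1)])
  next
    case (scale c x)
    then have "tscale c x \<in> C_p p" by (simp add: C_p_def sg_scale)
    then show ?case
      using scale by (intro ext) (simp_all add: representation_rules(2) [OF \<theta>(1)] representation_rules(2) [OF \<theta>'(1)])
  qed
qed

text \<open>Each generator sends \<open>xi a\<close> to 0 or to some \<open>xi a'\<close> with
  \<open>a' \<ge> a\<close>; for \<open>u\<close> this uses \<open>a < 1\<close>. \<open>a\<close>
  is generalised because in a product the bound for \<open>x\<close> is applied at every basis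
  vector that occurs in \<open>\<theta> y (xi a)\<close>.\<close>

lemma representation_keys:
  assumes \<theta>: "is_representation p \<theta>" "theta_equations p \<theta>"
    and "x \<in> C_p p" "a \<in> S01 p"
  shows "Poly_Mapping.keys (\<theta> x (xi a) :: real \<Rightarrow>\<^sub>0 'k) \<subseteq> {a..}"
  using assms(3,4)
proof (induction x arbitrary: a rule: C_p_induct)
  case (d b)
  then show ?case
    using theta_equations_rules(1) [OF \<theta>(2)] by (auto simp: xi_def S01_def)
next
  case u
  have "(a + of_nat p - 1) / of_nat p - a = (of_nat p - 1) * (1 - a) / of_nat p"
    using p_pos by (simp add: field_simps)
  also have "\<dots> \<ge> 0"
    using u p_gt_one by (simp add: S01_def)
  finally show ?case
    using theta_equations_rules(2) [OF \<theta>(2) u] by (auto simp: xi_def)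
next
  case v
  then have "a \<le> of_nat p * a"
    using p_gt_one by (simp add: S01_def mult_le_cancel_right1)
  then show ?case
    using theta_equations_rules(3) [OF \<theta>(2) v] by (auto simp: xi_def)
next
  case one
  have "\<theta> 1 (xi a) = xi a"
    using representation_one [OF \<theta>(1) xi_in_V_space' [OF one]] .
  then show ?case by (auto simp: xi_def)
next
  case (add x y)
  then show ?case
    by (simp add: representation_rules [OF \<theta>(1)] xi_in_V_space' keys_add_subset)
next
  case (mult x y)
  have xi: "xi a \<in> (V_space p :: (real \<Rightarrow>\<^sub>0 'k) set)" using mult(5) by (rule xi_in_V_space')
  have y: "\<theta> y (xi a) \<in> V_space p"
    by (rule End_V_in_V_space [OF representation_rules(1) [OF \<theta>(1) mult(2) xi] xi])
  have "Poly_Mapping.keys (\<theta> x (\<theta> y (xi a))) \<subseteq> {a..}"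
    by (rule End_V_keys_lower_bound [OF representation_rules(1) [OF \<theta>(1) mult(1) xi] _ y mult(4) [OF mult(5)]])
      (rule mult(3))
  then show ?case by (simp add: representation_rules(4) [OF \<theta>(1) mult(1) xi mult(2)])
next
  case (scale c x)
  then show ?case
    by (simp add: representation_rules [OF \<theta>(1)] xi_in_V_space' keys_vscale_subset)
qed

end

theorem proposition5p8:
  fixes p :: nat
  assumes "prime p"
    and "CHAR('k::field) = p"
    and "surj (\<lambda>x::'k. x ^ p)" \<comment> \<open>\<open>'k\<close> is perfect\<close>
  shows "\<exists>\<theta> :: (bc, 'k) tensor \<Rightarrow> (real \<Rightarrow>\<^sub>0 'k) \<Rightarrow> (real \<Rightarrow>\<^sub>0 'k).
    is_representation p \<theta> \<and> theta_equations p \<theta> \<and>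
    (\<forall>\<theta>'. is_representation p \<theta>' \<and> theta_equations p \<theta>' \<longrightarrow> (\<forall>x\<in>C_p p. \<theta>' x = \<theta> x)) \<and>
    inj_on \<theta> (C_p p) \<and>
    (\<forall>x\<in>C_p p. \<exists>M. is_matrix_of p M (\<theta> x) \<and> lower_triangular p M)"
proof -
  interpret char_p p "TYPE('k)"
    by standard (use assms in auto)
  have "\<exists>M. is_matrix_of p M (theta x) \<and> lower_triangular p M" if x: "x \<in> C_p p" for x
  proof (intro exI conjI)
    show "is_matrix_of p (\<lambda>a b. Poly_Mapping.lookup (theta x (xi b)) a) (theta x)"
      by (rule End_V_matrix [OF theta_in_End_V [OF x]])
    show "lower_triangular p (\<lambda>a b. Poly_Mapping.lookup (theta x (xi b)) a)"
      using representation_keys [OF is_representation_theta theta_equations_theta x]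
      unfolding lower_triangular_def by (metis atLeast_iff in_keys_iff subsetD)
  qed
  then show ?thesis
    by (intro exI [of _ theta] conjI allI impI ballI is_representation_theta theta_equations_theta
        inj_on_theta representation_unique [OF is_representation_theta theta_equations_theta])
      auto
qed

end
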